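(* Let $\varphi\colon R\to S$ be a homomorphism of commutative rings and let $N$ be an $S$-module. The following are equivalent: (a) the inclusion $\mathrm{Quad}_S(M,N)\subseteq\mathrm{Quad}_\varphi(M,N)$ is an equality for all $S$-modules $M$; (b) the inclusion $\mathrm{Quad}_S(M,N)\subseteq\mathrm{Quad}_\varphi(M,N)$ is an equality for $M=S^2$; (c) the multiplication of $S$ (that is, precomposition with the augmentation $\mathrm{Q}_\varphi\to S$) induces an isomorphism $N=\mathrm{Hom}_S(S,N)\to\mathrm{Hom}_S(\mathrm{Q}_\varphi,N)$. Moreover, in general $$\mathrm{Quad}_\varphi(S^2,N)\cong\mathrm{Quad}_S(S^2,N)\oplus\mathrm{Hom}_S(\mathrm{W}_\varphi,N).$$
   Context: For a map $q\colon M\to N$ between abelian groups, its polarisation is $\mathrm{pol}_q(x,y)=q(x+y)-q(x)-q(y)$. For a homomorphism $\varphi\colon R\to S$ of commutative rings and $S$-modules $M,N$, $\mathrm{Quad}_\varphi(M,N)$ denotes the $S$-module (under pointwise operations) of maps $q\colon M\to N$ with $q(sm)=s^2q(m)$ for all $s\in S$, $m\in M$, and with $\mathrm{pol}_q\colon M\times M\to N$ being $R$-bilinear, where $M,N$ are $R$-modules via $\varphi$. One writes $\mathrm{Quad}_S=\mathrm{Quad}_{\mathrm{id}_S}$. Let $\Delta_\varphi\subseteq S\otimes_R S$ be the $R$-subalgebra spanned by the elements $s\otimes s$, $s\in S$; regard $S$ as a $\Delta_\varphi$-algebra via the restriction of the multiplication map $S\otimes_R S\to S$. Put $\mathrm{Q}_\varphi=(S\otimes_R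 S)\otimes_{\Delta_\varphi}S$, an $S$-algebra via $s\mapsto 1\otimes 1\otimes s$, augmented over $S$ by the multiplication $s\otimes s'\otimes t\mapsto ss't$. Let $\mathrm{W}_\varphi$ be the kernel of the augmentation $\mathrm{Q}_\varphi\to S$, so that $\mathrm{Q}_\varphi\cong S\oplus\mathrm{W}_\varphi$ as $S$-modules. *)

theory Defs
  imports "HOL-Algebra.Module" "HOL-Algebra.QuotRing" "HOL-Algebra.Free_Abelian_Groups"
begin

section \<open>Modules, bilinear maps and homomorphisms\<close>

definition restrict_scalars ::
    "('r \<Rightarrow> 's) \<Rightarrow> ('s, 'm, 'x) module_scheme \<Rightarrow> ('r, 'm) module" where
  "restrict_scalars \<phi> M =
     \<lparr>carrier = carrier M, mult = mult M, one = one M, ring.zero = ring.zero M, add = add M,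
      smult = (\<lambda>r m. \<phi> r \<odot>\<^bsub>M\<^esub> m)\<rparr>"

definition algebra_module ::
    "('s \<Rightarrow> 'b) \<Rightarrow> ('b, 'x) ring_scheme \<Rightarrow> ('s, 'b) module" where
  "algebra_module f B =
     \<lparr>carrier = carrier B, mult = mult B, one = one B, ring.zero = ring.zero B, add = add B,
      smult = (\<lambda>s b. f s \<otimes>\<^bsub>B\<^esub> b)\<rparr>"

abbreviation self_module :: "('s, 'x) ring_scheme \<Rightarrow> ('s, 's) module" where
  "self_module S \<equiv> algebra_module (\<lambda>s. s) S"

text \<open>
  A module record also carries a multiplication and a unit, which play no role for modules
  (see \<^locale>\<open>module\<close>); in the modules built below they are left unspecified.
\<close>

definition direct_sum ::
    "('s, 'm, 'x) module_scheme \<Rightarrow> ('s, 'n, 'y) module_scheme \<Rightarrow> ('s, 'm \<times> 'n) module" where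
  "direct_sum M N =
     \<lparr>carrier = carrier M \<times> carrier N, mult = undefined, one = undefined,
      ring.zero = (\<zero>\<^bsub>M\<^esub>, \<zero>\<^bsub>N\<^esub>),
      add = (\<lambda>(m, n) (m', n'). (m \<oplus>\<^bsub>M\<^esub> m', n \<oplus>\<^bsub>N\<^esub> n')),
      smult = (\<lambda>s (m, n). (s \<odot>\<^bsub>M\<^esub> m, s \<odot>\<^bsub>N\<^esub> n))\<rparr>"

definition pointwise_module ::
    "'m set \<Rightarrow> ('s, 'n, 'y) module_scheme \<Rightarrow> ('m \<Rightarrow> 'n) set \<Rightarrow> ('s, 'm \<Rightarrow> 'n) module" where
  "pointwise_module A N X =
     \<lparr>carrier = X, mult = undefined, one = undefined,
      ring.zero = (\<lambda>m\<in>A. \<zero>\<^bsub>N\<^esub>),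
      add = (\<lambda>f g. \<lambda>m\<in>A. f m \<oplus>\<^bsub>N\<^esub> g m),
      smult = (\<lambda>s f. \<lambda>m\<in>A. s \<odot>\<^bsub>N\<^esub> f m)\<rparr>"

definition linear_map ::
    "('s, 'q) ring_scheme \<Rightarrow> ('s, 'm, 'x) module_scheme \<Rightarrow> ('s, 'n, 'y) module_scheme
      \<Rightarrow> ('m \<Rightarrow> 'n) \<Rightarrow> bool" where
  "linear_map S M N f \<longleftrightarrow>
     f \<in> carrier M \<rightarrow> carrier N \<and>
     (\<forall>x\<in>carrier M. \<forall>y\<in>carrier M. f (x \<oplus>\<^bsub>M\<^esub> y) = f x \<oplus>\<^bsub>N\<^esub> f y) \<and>
     (\<forall>s\<in>carrier S. \<forall>x\<in>carrier M. f (s \<odot>\<^bsub>M\<^esub> x) = s \<odot>\<^bsub>N\<^esub> f x)"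

definition module_iso ::
    "('s, 'q) ring_scheme \<Rightarrow> ('s, 'm, 'x) module_scheme \<Rightarrow> ('s, 'n, 'y) module_scheme
      \<Rightarrow> ('m \<Rightarrow> 'n) \<Rightarrow> bool" where
  "module_iso S M N f \<longleftrightarrow> linear_map S M N f \<and> bij_betw f (carrier M) (carrier N)"

definition isomorphic_modules ::
    "('s, 'q) ring_scheme \<Rightarrow> ('s, 'm, 'x) module_scheme \<Rightarrow> ('s, 'n, 'y) module_scheme \<Rightarrow> bool" where
  "isomorphic_modules S M N \<longleftrightarrow> (\<exists>f. module_iso S M N f)"

definition bilinear_map ::
    "('r, 'p) ring_scheme \<Rightarrow> ('r, 'm, 'x) module_scheme \<Rightarrow> ('r, 'n, 'y) module_scheme
      \<Rightarrow> ('m \<Rightarrow> 'm \<Rightarrow> 'n) \<Rightarrow> bool" where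
  "bilinear_map R M N b \<longleftrightarrow>
     (\<forall>x\<in>carrier M. linear_map R M N (b x)) \<and>
     (\<forall>y\<in>carrier M. linear_map R M N (\<lambda>x. b x y))"

definition Hom ::
    "('s, 'q) ring_scheme \<Rightarrow> ('s, 'm, 'x) module_scheme \<Rightarrow> ('s, 'n, 'y) module_scheme
      \<Rightarrow> ('s, 'm \<Rightarrow> 'n) module" where
  "Hom S M N = pointwise_module (carrier M) N
     {f \<in> carrier M \<rightarrow>\<^sub>E carrier N. linear_map S M N f}"


section \<open>Quadratic maps\<close>

definition pol ::
    "('s, 'm, 'x) module_scheme \<Rightarrow> ('s, 'n, 'y) module_scheme \<Rightarrow> ('m \<Rightarrow> 'n) \<Rightarrow> 'm \<Rightarrow> 'm \<Rightarrow> 'n" where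
  "pol M N q x y = q (x \<oplus>\<^bsub>M\<^esub> y) \<ominus>\<^bsub>N\<^esub> q x \<ominus>\<^bsub>N\<^esub> q y"

text \<open>
  Maps are extensional (\<open>undefined\<close> outside \<open>carrier M\<close>), so that equality of functions is
  equality on the carrier; likewise in \<open>Hom\<close>.

  A quantification over all \<open>S\<close>-modules \<open>M\<close> ranges over records of some fixed type
  \<open>('s, 'm) module\<close>. If it is to include \<open>S\<^sup>2\<close> for an arbitrary type \<open>'m\<close>, it has to
  range over the modules with elements in \<open>'m\<close> together with those with elements in
  \<open>'s \<times> 's\<close>.
\<close>

definition Quad ::
    "('r, 'p) ring_scheme \<Rightarrow> ('s, 'q) ring_scheme \<Rightarrow> ('r \<Rightarrow> 's)
      \<Rightarrow> ('s, 'm, 'x) module_scheme \<Rightarrow> ('s, 'n, 'y) module_scheme \<Rightarrow> ('s, 'm \<Rightarrow> 'n) module" where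
  "Quad R S \<phi> M N = pointwise_module (carrier M) N
     {q \<in> carrier M \<rightarrow>\<^sub>E carrier N.
        (\<forall>s\<in>carrier S. \<forall>m\<in>carrier M. q (s \<odot>\<^bsub>M\<^esub> m) = (s \<otimes>\<^bsub>S\<^esub> s) \<odot>\<^bsub>N\<^esub> q m) \<and>
        bilinear_map R (restrict_scalars \<phi> M) (restrict_scalars \<phi> N) (pol M N q)}"

abbreviation Quad_id ::
    "('s, 'q) ring_scheme \<Rightarrow> ('s, 'm, 'x) module_scheme \<Rightarrow> ('s, 'n, 'y) module_scheme
      \<Rightarrow> ('s, 'm \<Rightarrow> 'n) module" where
  "Quad_id S M N \<equiv> Quad S S (\<lambda>s. s) M N"


lemma Quad_id_subset_Quad:
  assumes "ring_hom_cring R S \<phi>"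
  shows "carrier (Quad_id S M N) \<subseteq> carrier (Quad R S \<phi> M N)"
proof -
  interpret ring_hom_cring R S \<phi> by fact
  show ?thesis
    by (auto simp: Quad_def pointwise_module_def bilinear_map_def linear_map_def
        restrict_scalars_def)
qed


section \<open>Tensor products of commutative algebras\<close>

text \<open>
  For commutative algebras \<open>f : A \<rightarrow> B\<close> and \<open>g : A \<rightarrow> C\<close>, the additive group of
  \<open>B \<otimes>\<^sub>A C\<close> is the free abelian group on \<open>B \<times> C\<close> modulo the subgroup generated by the usual
  relations. The free abelian group is given the multiplication of the integral monoid ring
  of \<open>B \<times> C\<close>. The relations are stable under multiplication by pairs, so the subgroup
  is an ideal, and the quotient multiplication is
  \<open>(b \<otimes> c)(b' \<otimes> c') = bb' \<otimes> cc'\<close>.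
\<close>

definition int_monoid_ring :: "('g, 'x) monoid_scheme \<Rightarrow> ('g \<Rightarrow>\<^sub>0 int) ring" where
  "int_monoid_ring G =
     \<lparr>carrier = carrier (free_Abelian_group (carrier G)),
      mult = (\<lambda>x y. frag_extend (\<lambda>g. frag_extend (\<lambda>h. frag_of (g \<otimes>\<^bsub>G\<^esub> h)) y) x),
      one = frag_of \<one>\<^bsub>G\<^esub>, ring.zero = 0, add = (+)\<rparr>"

definition tensor_relators ::
    "('a, 'x) ring_scheme \<Rightarrow> ('b, 'y) ring_scheme \<Rightarrow> ('c, 'z) ring_scheme
      \<Rightarrow> ('a \<Rightarrow> 'b) \<Rightarrow> ('a \<Rightarrow> 'c) \<Rightarrow> ('b \<times> 'c \<Rightarrow>\<^sub>0 int) set" where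
  "tensor_relators A B C f g =
     {frag_of (b \<oplus>\<^bsub>B\<^esub> b', c) - frag_of (b, c) - frag_of (b', c) | b b' c.
        b \<in> carrier B \<and> b' \<in> carrier B \<and> c \<in> carrier C} \<union>
     {frag_of (b, c \<oplus>\<^bsub>C\<^esub> c') - frag_of (b, c) - frag_of (b, c') | b c c'.
        b \<in> carrier B \<and> c \<in> carrier C \<and> c' \<in> carrier C} \<union>
     {frag_of (f a \<otimes>\<^bsub>B\<^esub> b, c) - frag_of (b, g a \<otimes>\<^bsub>C\<^esub> c) | a b c.
        a \<in> carrier A \<and> b \<in> carrier B \<and> c \<in> carrier C}"

definition tensor_kernel ::
    "('a, 'x) ring_scheme \<Rightarrow> ('b, 'y) ring_scheme \<Rightarrow> ('c, 'z) ring_scheme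
      \<Rightarrow> ('a \<Rightarrow> 'b) \<Rightarrow> ('a \<Rightarrow> 'c) \<Rightarrow> ('b \<times> 'c \<Rightarrow>\<^sub>0 int) set" where
  "tensor_kernel A B C f g =
     generate (free_Abelian_group (carrier B \<times> carrier C)) (tensor_relators A B C f g)"

definition tensor_ring ::
    "('a, 'x) ring_scheme \<Rightarrow> ('b, 'y) ring_scheme \<Rightarrow> ('c, 'z) ring_scheme
      \<Rightarrow> ('a \<Rightarrow> 'b) \<Rightarrow> ('a \<Rightarrow> 'c) \<Rightarrow> ('b \<times> 'c \<Rightarrow>\<^sub>0 int) set ring" where
  "tensor_ring A B C f g = int_monoid_ring (B \<times>\<times> C) Quot tensor_kernel A B C f g"

definition tensor_elem ::
    "('a, 'x) ring_scheme \<Rightarrow> ('b, 'y) ring_scheme \<Rightarrow> ('c, 'z) ring_scheme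
      \<Rightarrow> ('a \<Rightarrow> 'b) \<Rightarrow> ('a \<Rightarrow> 'c) \<Rightarrow> 'b \<Rightarrow> 'c \<Rightarrow> ('b \<times> 'c \<Rightarrow>\<^sub>0 int) set" where
  "tensor_elem A B C f g b c =
     tensor_kernel A B C f g +>\<^bsub>int_monoid_ring (B \<times>\<times> C)\<^esub> frag_of (b, c)"

text \<open>
  \<open>tensor_lift P h\<close> sends \<open>b \<otimes> c\<close> to \<open>h b c\<close>, extended additively. It is evaluated on an
  arbitrary representative of the coset and is meaningful when \<open>h\<close> is biadditive and balanced.
\<close>

definition tensor_lift ::
    "('p, 'x) ring_scheme \<Rightarrow> ('b \<Rightarrow> 'c \<Rightarrow> 'p) \<Rightarrow> ('b \<times> 'c \<Rightarrow>\<^sub>0 int) set \<Rightarrow> 'p" where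
  "tensor_lift P h X =
     the_elem ((\<lambda>x. \<Oplus>\<^bsub>P\<^esub>k\<in>Poly_Mapping.keys x.
                      [Poly_Mapping.lookup x k] \<cdot>\<^bsub>P\<^esub> h (fst k) (snd k)) ` X)"


section \<open>The algebra $Q$ and its augmentation kernel $W$\<close>

type_synonym 's tens = "('s \<times> 's \<Rightarrow>\<^sub>0 int) set"
type_synonym 's tens_Q = "('s tens \<times> 's \<Rightarrow>\<^sub>0 int) set"

definition SS_ring ::
    "('r, 'p) ring_scheme \<Rightarrow> ('s, 'q) ring_scheme \<Rightarrow> ('r \<Rightarrow> 's) \<Rightarrow> 's tens ring" where
  "SS_ring R S \<phi> = tensor_ring R S S \<phi> \<phi>"

definition SS_elem ::
    "('r, 'p) ring_scheme \<Rightarrow> ('s, 'q) ring_scheme \<Rightarrow> ('r \<Rightarrow> 's) \<Rightarrow> 's \<Rightarrow> 's \<Rightarrow> 's tens" where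
  "SS_elem R S \<phi> = tensor_elem R S S \<phi> \<phi>"

definition SS_mult :: "('s, 'q) ring_scheme \<Rightarrow> 's tens \<Rightarrow> 's" where
  "SS_mult S = tensor_lift S (\<lambda>s s'. s \<otimes>\<^bsub>S\<^esub> s')"

text \<open>
  The \<open>R\<close>-span of the elements \<open>s \<otimes> s\<close>, i.e. the additive subgroup generated by the
  \<open>r \<cdot> (s \<otimes> s) = \<phi>(r)s \<otimes> s\<close>. It is already a subring, since
  \<open>(s \<otimes> s)(t \<otimes> t) = st \<otimes> st\<close>.
\<close>

definition Delta ::
    "('r, 'p) ring_scheme \<Rightarrow> ('s, 'q) ring_scheme \<Rightarrow> ('r \<Rightarrow> 's) \<Rightarrow> 's tens ring" where
  "Delta R S \<phi> = (SS_ring R S \<phi>)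
     \<lparr>carrier := generate (add_monoid (SS_ring R S \<phi>))
        {SS_elem R S \<phi> (\<phi> r \<otimes>\<^bsub>S\<^esub> s) s | r s. r \<in> carrier R \<and> s \<in> carrier S}\<rparr>"

definition Q_ring ::
    "('r, 'p) ring_scheme \<Rightarrow> ('s, 'q) ring_scheme \<Rightarrow> ('r \<Rightarrow> 's) \<Rightarrow> 's tens_Q ring" where
  "Q_ring R S \<phi> = tensor_ring (Delta R S \<phi>) (SS_ring R S \<phi>) S (\<lambda>d. d) (SS_mult S)"

definition Q_elem ::
    "('r, 'p) ring_scheme \<Rightarrow> ('s, 'q) ring_scheme \<Rightarrow> ('r \<Rightarrow> 's) \<Rightarrow> 's tens \<Rightarrow> 's \<Rightarrow> 's tens_Q" where
  "Q_elem R S \<phi> = tensor_elem (Delta R S \<phi>) (SS_ring R S \<phi>) S (\<lambda>d. d) (SS_mult S)"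

definition Q_module ::
    "('r, 'p) ring_scheme \<Rightarrow> ('s, 'q) ring_scheme \<Rightarrow> ('r \<Rightarrow> 's) \<Rightarrow> ('s, 's tens_Q) module" where
  "Q_module R S \<phi> =
     algebra_module (\<lambda>s. Q_elem R S \<phi> (SS_elem R S \<phi> \<one>\<^bsub>S\<^esub> \<one>\<^bsub>S\<^esub>) s) (Q_ring R S \<phi>)"

definition Q_aug :: "('s, 'q) ring_scheme \<Rightarrow> 's tens_Q \<Rightarrow> 's" where
  "Q_aug S = tensor_lift S (\<lambda>x t. SS_mult S x \<otimes>\<^bsub>S\<^esub> t)"

definition W_module ::
    "('r, 'p) ring_scheme \<Rightarrow> ('s, 'q) ring_scheme \<Rightarrow> ('r \<Rightarrow> 's) \<Rightarrow> ('s, 's tens_Q) module" where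
  "W_module R S \<phi> = (Q_module R S \<phi>)\<lparr>carrier := a_kernel (Q_ring R S \<phi>) S (Q_aug S)\<rparr>"

text \<open>
  The identification \<open>N = Hom\<^sub>S(S, N)\<close>, followed by precomposition with the augmentation.
\<close>

definition scalar_hom ::
    "('s, 'q) ring_scheme \<Rightarrow> ('s, 'n, 'y) module_scheme \<Rightarrow> 'n \<Rightarrow> 's \<Rightarrow> 'n" where
  "scalar_hom S N n = (\<lambda>s\<in>carrier S. s \<odot>\<^bsub>N\<^esub> n)"

definition aug_pullback ::
    "('r, 'p) ring_scheme \<Rightarrow> ('s, 'q) ring_scheme \<Rightarrow> ('r \<Rightarrow> 's) \<Rightarrow> ('s \<Rightarrow> 'n) \<Rightarrow> 's tens_Q \<Rightarrow> 'n" where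
  "aug_pullback R S \<phi> f = compose (carrier (Q_module R S \<phi>)) f (Q_aug S)"

end

(*
  A quadratic map q on S^2 is q(x, y) = x^2 q(1, 0) + y^2 q(0, 1) + beta(x, y), where beta, the
  restriction of pol_q to the two coordinate axes, is R-bilinear and satisfies
  beta(s x, s y) = s^2 beta(x, y). Such a beta extends to S (x)_R S, and the last condition says
  that the extension is compatible with the action of Delta through the multiplication, so that
  these forms are exactly beta(x, y) = h (x (x) y (x) 1) for linear maps h from Q to N. Over S itself
  they are beta(x, y) = x y n, which corresponds to h = aug n. Hence (b) and (c) both say that all
  forms are of the shape x y n. As x, y |-> pol_q (x m, y m') is such a form for every q on any M,
  this shape also makes every pol_q S-bilinear, which is (a). The decomposition comes from
  Q = S 1 (+) W: the pair (p, g) is sent to p(x, y) + g (x (x) y (x) 1 - x y 1).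
*)

theory Submission
  imports Defs
begin

section \<open>Integral monoid rings\<close>

text \<open>A tensor product here is a set of cosets of formal integer combinations, so a map out of
  it has to be shown independent of representatives. Apart from the product rule for pure tensors,
  two facts replace all computation with cosets: sums of pure tensors exhaust the ring, and
  biadditive balanced maps extend to it. They are proved for an arbitrary pair of commutative rings
  and used both for S (x)_R S and for Q, whose left factor is S (x)_R S. Compatibility of beta with
  Delta is verified on the elements phi(r) s (x) s alone; it spreads to their span because both
  sides are additive in the element of Delta. The equivalences are organised around one condition on
  forms that mentions neither M nor Q, and each of (a), (b), (c) is compared with it.\<close>

lemma int_monoid_ring_simps [simp]:
  "x \<in> carrier (int_monoid_ring G) \<longleftrightarrow> Poly_Mapping.keys x \<subseteq> carrier G"
  "x \<oplus>\<^bsub>int_monoid_ring G\<^esub> y = x + y"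
  "\<zero>\<^bsub>int_monoid_ring G\<^esub> = 0"
  "\<one>\<^bsub>int_monoid_ring G\<^esub> = frag_of \<one>\<^bsub>G\<^esub>"
  by (auto simp: int_monoid_ring_def)

lemma add_monoid_int_monoid_ring:
  "add_monoid (int_monoid_ring G) = free_Abelian_group (carrier G)"
  by (simp add: int_monoid_ring_def free_Abelian_group_def)

text \<open>The product of the monoid ring extends over its left factor a function that is itself an
  extension over the right factor. Additivity in the right factor therefore needs additivity of
  \<open>frag_extend\<close> in the function.\<close>

lemma frag_extend_fun_diff:
  fixes u v :: "'g \<Rightarrow> 'h \<Rightarrow>\<^sub>0 int"
  shows "frag_extend (\<lambda>g. u g - v g) x = frag_extend u x - frag_extend v x"
proof -
  have "frag_cmul k (a - b) = frag_cmul k a - frag_cmul k b" for k and a b :: "'h \<Rightarrow>\<^sub>0 int"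
    by (rule poly_mapping_eqI) (simp add: lookup_minus right_diff_distrib)
  then show ?thesis
    by (simp add: frag_extend_def sum_subtractf)
qed

text \<open>Biadditivity and the values on generators determine the product. Differences take the
  place of sums because \<open>frag_induction\<close> builds formal combinations by
  differences.\<close>

lemma int_monoid_ring_mult:
  "0 \<otimes>\<^bsub>int_monoid_ring G\<^esub> y = 0"
  "x \<otimes>\<^bsub>int_monoid_ring G\<^esub> 0 = 0"
  "(x - x') \<otimes>\<^bsub>int_monoid_ring G\<^esub> y = x \<otimes>\<^bsub>int_monoid_ring G\<^esub> y - x' \<otimes>\<^bsub>int_monoid_ring G\<^esub> y"
  "x \<otimes>\<^bsub>int_monoid_ring G\<^esub> (y - y') = x \<otimes>\<^bsub>int_monoid_ring G\<^esub> y - x \<otimes>\<^bsub>int_monoid_ring G\<^esub> y'"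
  "frag_of a \<otimes>\<^bsub>int_monoid_ring G\<^esub> frag_of b = frag_of (a \<otimes>\<^bsub>G\<^esub> b)"
  by (simp_all add: int_monoid_ring_def frag_extend_diff frag_extend_fun_diff frag_extend_eq_0)

text \<open>Commutativity, associativity and the unit law are additive in each argument, so they
  reduce to the generators \<open>frag_of g\<close>, where they are the laws of the monoid
  \<open>G\<close>.\<close>

lemma cring_int_monoid_ring:
  assumes "comm_monoid G"
  shows "cring (int_monoid_ring G)"
proof -
  interpret G: comm_monoid G by fact
  let ?Z = "int_monoid_ring G"
  have "comm_group (add_monoid ?Z)"
    unfolding add_monoid_int_monoid_ring by (rule abelian_free_Abelian_group)
  then have ab: "abelian_group ?Z"
    unfolding abelian_group_def abelian_monoid_def abelian_group_axioms_def
    by (simp add: comm_group.axioms)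
  have closed: "Poly_Mapping.keys (x \<otimes>\<^bsub>?Z\<^esub> y) \<subseteq> carrier G"
    if "Poly_Mapping.keys x \<subseteq> carrier G" "Poly_Mapping.keys y \<subseteq> carrier G" for x y
    using that(1)
  proof (induction x rule: frag_induction)
    case (one a)
    show ?case using that(2)
    proof (induction y rule: frag_induction)
      case (diff x y)
      then show ?case
        using keys_diff by (fastforce simp: int_monoid_ring_mult)
    qed (use one in \<open>auto simp: int_monoid_ring_mult\<close>)
  next
    case (diff x x')
    then show ?case
      using keys_diff by (fastforce simp: int_monoid_ring_mult)
  qed (simp add: int_monoid_ring_mult)
  have comm: "x \<otimes>\<^bsub>?Z\<^esub> y = y \<otimes>\<^bsub>?Z\<^esub> x"
    if "Poly_Mapping.keys x \<subseteq> carrier G" "Poly_Mapping.keys y \<subseteq> carrier G" for x y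
    using that(1)
  proof (induction x rule: frag_induction)
    case (one a)
    show ?case using that(2)
      by (induction y rule: frag_induction)
        (use one in \<open>auto simp: int_monoid_ring_mult G.m_comm\<close>)
  qed (auto simp: int_monoid_ring_mult)
  have assoc: "x \<otimes>\<^bsub>?Z\<^esub> y \<otimes>\<^bsub>?Z\<^esub> z = x \<otimes>\<^bsub>?Z\<^esub> (y \<otimes>\<^bsub>?Z\<^esub> z)"
    if "Poly_Mapping.keys x \<subseteq> carrier G" "Poly_Mapping.keys y \<subseteq> carrier G"
      "Poly_Mapping.keys z \<subseteq> carrier G" for x y z
    using that(1)
  proof (induction x rule: frag_induction)
    case (one a)
    show ?case using that(2)
    proof (induction y rule: frag_induction)
      case 2: (one b)
      show ?case using that(3)
        by (induction z rule: frag_induction)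
          (use one 2 in \<open>auto simp: int_monoid_ring_mult G.m_assoc\<close>)
    qed (auto simp: int_monoid_ring_mult)
  qed (auto simp: int_monoid_ring_mult)
  have one: "frag_of \<one>\<^bsub>G\<^esub> \<otimes>\<^bsub>?Z\<^esub> x = x" if "Poly_Mapping.keys x \<subseteq> carrier G" for x
    using that by (induction x rule: frag_induction) (auto simp: int_monoid_ring_mult)
  have distr: "(x + x') \<otimes>\<^bsub>?Z\<^esub> y = x \<otimes>\<^bsub>?Z\<^esub> y + x' \<otimes>\<^bsub>?Z\<^esub> y" for x x' y
    by (simp add: int_monoid_ring_def frag_extend_add)
  show ?thesis
    by (intro cringI ab comm_monoidI)
      (simp_all add: closed assoc one distr, simp add: comm)
qed

lemma int_monoid_ring_minus:
  assumes "Poly_Mapping.keys x \<subseteq> carrier G"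
  shows "\<ominus>\<^bsub>int_monoid_ring G\<^esub> x = - x"
  using assms unfolding a_inv_def add_monoid_int_monoid_ring by simp

section \<open>Tensor products\<close>

text \<open>Coefficients may cancel in \<open>x + y\<close>, so the three sums run over different
  supports. All are extended to the union of the supports of \<open>x\<close> and \<open>y\<close>,
  where the added terms have coefficient zero.\<close>

lemma finsum_frag_add:
  fixes P (structure) and x y :: "'k \<Rightarrow>\<^sub>0 int"
  assumes "abelian_group P" "\<And>k. k \<in> K \<Longrightarrow> h k \<in> carrier P"
    and "Poly_Mapping.keys x \<subseteq> K" "Poly_Mapping.keys y \<subseteq> K"
  shows "(\<Oplus>k\<in>Poly_Mapping.keys (x + y). [Poly_Mapping.lookup (x + y) k] \<cdot> h k) =
    (\<Oplus>k\<in>Poly_Mapping.keys x. [Poly_Mapping.lookup x k] \<cdot> h k) \<oplus>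
    (\<Oplus>k\<in>Poly_Mapping.keys y. [Poly_Mapping.lookup y k] \<cdot> h k)"
proof -
  interpret P: abelian_group P by fact
  let ?U = "Poly_Mapping.keys x \<union> Poly_Mapping.keys y"
  have U: "k \<in> ?U \<Longrightarrow> h k \<in> carrier P" for k
    using assms by blast
  have ext: "(\<Oplus>k\<in>Poly_Mapping.keys z. [Poly_Mapping.lookup z k] \<cdot> h k) =
      (\<Oplus>k\<in>?U. [Poly_Mapping.lookup z k] \<cdot> h k)" if "Poly_Mapping.keys z \<subseteq> ?U" for z :: "'k \<Rightarrow>\<^sub>0 int"
  proof (rule P.add.finprod_mono_neutral_cong_left)
    show "[Poly_Mapping.lookup z k] \<cdot> h k = \<zero>" if "k \<in> ?U - Poly_Mapping.keys z" for k
      using that by (simp add: in_keys_iff add_pow_def int_pow_def2 nat_pow_def)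
    show "(\<lambda>k. [Poly_Mapping.lookup z k] \<cdot> h k) \<in> ?U \<rightarrow> carrier P"
      using U by (intro Pi_I P.add.int_pow_closed)
  qed (use that in auto)
  have "(\<Oplus>k\<in>?U. [Poly_Mapping.lookup (x + y) k] \<cdot> h k) =
      (\<Oplus>k\<in>?U. [Poly_Mapping.lookup x k] \<cdot> h k \<oplus> [Poly_Mapping.lookup y k] \<cdot> h k)"
    using U by (intro P.finsum_cong') (auto simp: lookup_add P.add.int_pow_mult)
  also have "\<dots> = (\<Oplus>k\<in>?U. [Poly_Mapping.lookup x k] \<cdot> h k) \<oplus>
      (\<Oplus>k\<in>?U. [Poly_Mapping.lookup y k] \<cdot> h k)"
    using U by (intro P.finsum_addf) auto
  finally show ?thesis
    unfolding ext[OF keys_add] ext[OF Un_upper1] ext[OF Un_upper2] .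
qed

text \<open>The base \<open>A\<close> enters through \<open>f\<close> and \<open>g\<close> only, as
  the index set of the balancing relators. For Q this lets \<open>Delta\<close> act as the base as
  soon as its elements are known to lie in S (x)_R S.\<close>

locale tensor_product = B?: cring B + C?: cring C
  for A :: "('a, 'x) ring_scheme" and B :: "('b, 'y) ring_scheme" (structure)
    and C :: "('c, 'z) ring_scheme" (structure) +
  fixes f :: "'a \<Rightarrow> 'b" and g :: "'a \<Rightarrow> 'c"
  assumes f_closed: "a \<in> carrier A \<Longrightarrow> f a \<in> carrier B"
    and g_closed: "a \<in> carrier A \<Longrightarrow> g a \<in> carrier C"
begin

abbreviation Z where "Z \<equiv> int_monoid_ring (B \<times>\<times> C)"
abbreviation I where "I \<equiv> tensor_kernel A B C f g"
abbreviation T where "T \<equiv> tensor_ring A B C f g"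
abbreviation t where "t \<equiv> tensor_elem A B C f g"

lemma comm_monoid_DirProd: "comm_monoid (B \<times>\<times> C)"
  by (rule monoid.monoid_comm_monoidI[OF DirProd_monoid[OF B.monoid_axioms C.monoid_axioms]])
    (auto simp: B.m_comm C.m_comm)

sublocale Z: cring Z
  by (rule cring_int_monoid_ring[OF comm_monoid_DirProd])

section \<open>The subgroup of relations as an ideal\<close>

lemma tensor_relatorsI:
  "\<lbrakk>b \<in> carrier B; b' \<in> carrier B; c \<in> carrier C\<rbrakk> \<Longrightarrow>
    frag_of (b \<oplus>\<^bsub>B\<^esub> b', c) - frag_of (b, c) - frag_of (b', c) \<in> tensor_relators A B C f g"
  "\<lbrakk>b \<in> carrier B; c \<in> carrier C; c' \<in> carrier C\<rbrakk> \<Longrightarrow>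
    frag_of (b, c \<oplus>\<^bsub>C\<^esub> c') - frag_of (b, c) - frag_of (b, c') \<in> tensor_relators A B C f g"
  "\<lbrakk>a \<in> carrier A; b \<in> carrier B; c \<in> carrier C\<rbrakk> \<Longrightarrow>
    frag_of (f a \<otimes>\<^bsub>B\<^esub> b, c) - frag_of (b, g a \<otimes>\<^bsub>C\<^esub> c) \<in> tensor_relators A B C f g"
  unfolding tensor_relators_def by auto

lemma tensor_relatorsE [consumes 1, case_names left right balanced]:
  assumes "x \<in> tensor_relators A B C f g"
  obtains b b' c where "b \<in> carrier B" "b' \<in> carrier B" "c \<in> carrier C"
      "x = frag_of (b \<oplus>\<^bsub>B\<^esub> b', c) - frag_of (b, c) - frag_of (b', c)"
    | b c c' where "b \<in> carrier B" "c \<in> carrier C" "c' \<in> carrier C"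
      "x = frag_of (b, c \<oplus>\<^bsub>C\<^esub> c') - frag_of (b, c) - frag_of (b, c')"
    | a b c where "a \<in> carrier A" "b \<in> carrier B" "c \<in> carrier C"
      "x = frag_of (f a \<otimes>\<^bsub>B\<^esub> b, c) - frag_of (b, g a \<otimes>\<^bsub>C\<^esub> c)"
  using assms unfolding tensor_relators_def by auto

lemma tensor_relators_keys:
  "x \<in> tensor_relators A B C f g \<Longrightarrow> Poly_Mapping.keys x \<subseteq> carrier (B \<times>\<times> C)"
  unfolding tensor_relators_def
  by (auto simp: f_closed g_closed dest!: subsetD[OF keys_diff])

lemma add_monoid_Z: "add_monoid Z = free_Abelian_group (carrier B \<times> carrier C)"
  unfolding add_monoid_int_monoid_ring by simp

lemma tensor_kernel_subgroup: "subgroup I (add_monoid Z)"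
  unfolding tensor_kernel_def add_monoid_Z
  by (rule group.generate_is_subgroup) (use tensor_relators_keys in auto)

lemma I_keys: "x \<in> I \<Longrightarrow> Poly_Mapping.keys x \<subseteq> carrier B \<times> carrier C"
  using subgroup.subset[OF tensor_kernel_subgroup] unfolding add_monoid_Z by (meson carrier_free_Abelian_group_iff subsetD)

text \<open>A generator multiplies each relator into a relator of the same kind: by distributivity
  for the two additive kinds, and by commutativity for the balanced kind, where \<open>f a\<close>
  and \<open>g a\<close> are moved to the front. Landing in the relators themselves also takes care
  of their inverses in the generated subgroup.\<close>

lemma relator_mult_pure:
  assumes "r \<in> tensor_relators A B C f g" "b \<in> carrier B" "c \<in> carrier C"
  shows "frag_of (b, c) \<otimes>\<^bsub>Z\<^esub> r \<in> tensor_relators A B C f g"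
proof -
  from assms(1) show ?thesis
  proof (cases rule: tensor_relatorsE)
    case (left b1 b2 c1)
    then have "frag_of (b, c) \<otimes>\<^bsub>Z\<^esub> r =
      frag_of (b \<otimes>\<^bsub>B\<^esub> b1 \<oplus>\<^bsub>B\<^esub> b \<otimes>\<^bsub>B\<^esub> b2, c \<otimes>\<^bsub>C\<^esub> c1) - frag_of (b \<otimes>\<^bsub>B\<^esub> b1, c \<otimes>\<^bsub>C\<^esub> c1)
        - frag_of (b \<otimes>\<^bsub>B\<^esub> b2, c \<otimes>\<^bsub>C\<^esub> c1)"
      using assms by (simp add: int_monoid_ring_mult B.r_distr)
    then show ?thesis
      using assms left by (simp add: tensor_relatorsI)
  next
    case (right b1 c1 c2)
    then have "frag_of (b, c) \<otimes>\<^bsub>Z\<^esub> r =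
      frag_of (b \<otimes>\<^bsub>B\<^esub> b1, c \<otimes>\<^bsub>C\<^esub> c1 \<oplus>\<^bsub>C\<^esub> c \<otimes>\<^bsub>C\<^esub> c2) - frag_of (b \<otimes>\<^bsub>B\<^esub> b1, c \<otimes>\<^bsub>C\<^esub> c1)
        - frag_of (b \<otimes>\<^bsub>B\<^esub> b1, c \<otimes>\<^bsub>C\<^esub> c2)"
      using assms by (simp add: int_monoid_ring_mult C.r_distr)
    then show ?thesis
      using assms right by (simp add: tensor_relatorsI)
  next
    case (balanced a b1 c1)
    then have "frag_of (b, c) \<otimes>\<^bsub>Z\<^esub> r =
      frag_of (f a \<otimes>\<^bsub>B\<^esub> (b \<otimes>\<^bsub>B\<^esub> b1), c \<otimes>\<^bsub>C\<^esub> c1) - frag_of (b \<otimes>\<^bsub>B\<^esub> b1, g a \<otimes>\<^bsub>C\<^esub> (c \<otimes>\<^bsub>C\<^esub> c1))"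
      using assms f_closed g_closed
      by (simp add: int_monoid_ring_mult B.m_lcomm C.m_lcomm)
    then show ?thesis
      using assms balanced by (simp add: tensor_relatorsI)
  qed
qed

lemma I_diff: "x \<in> I \<Longrightarrow> y \<in> I \<Longrightarrow> x - y \<in> I"
  using subgroup.m_closed[OF tensor_kernel_subgroup, of x "- y"]
    subgroup.m_inv_closed[OF tensor_kernel_subgroup, of y] I_keys[of y]
  unfolding add_monoid_Z by simp

text \<open>Multiplication is additive in both factors, so stability passes from relators to the
  subgroup they generate, and from generators of the monoid ring to all its elements.\<close>

lemma ideal_tensor_kernel: "ideal I Z"
proof -
  have pure: "frag_of (b, c) \<otimes>\<^bsub>Z\<^esub> r \<in> I"
    if "r \<in> I" "b \<in> carrier B" "c \<in> carrier C" for r b c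
    using that(1) unfolding tensor_kernel_def
  proof (induction r rule: generate.induct)
    case one
    then show ?case
      by (simp add: int_monoid_ring_mult) (metis generate.one one_free_Abelian_group)
  next
    case (incl h)
    then show ?case
      using relator_mult_pure that by (blast intro: generate.incl)
  next
    case (inv h)
    have k: "Poly_Mapping.keys h \<subseteq> carrier B \<times> carrier C"
      "Poly_Mapping.keys (frag_of (b, c) \<otimes>\<^bsub>Z\<^esub> h) \<subseteq> carrier B \<times> carrier C"
      using tensor_relators_keys inv relator_mult_pure that by auto
    have "frag_of (b, c) \<otimes>\<^bsub>Z\<^esub> (- h) = - (frag_of (b, c) \<otimes>\<^bsub>Z\<^esub> h)"
      using int_monoid_ring_mult(4)[of _ _ 0 h] by (simp add: int_monoid_ring_mult)
    then show ?case
      using generate.inv[OF relator_mult_pure[OF inv that(2,3)], of "free_Abelian_group (carrier B \<times> carrier C)"] k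
      by simp
  next
    case (eng h1 h2)
    have "Poly_Mapping.keys h1 \<subseteq> carrier B \<times> carrier C" "Poly_Mapping.keys h2 \<subseteq> carrier B \<times> carrier C"
      using eng I_keys unfolding tensor_kernel_def by blast+
    then have "frag_of (b, c) \<otimes>\<^bsub>Z\<^esub> (h1 + h2) = frag_of (b, c) \<otimes>\<^bsub>Z\<^esub> h1 + frag_of (b, c) \<otimes>\<^bsub>Z\<^esub> h2"
      using Z.r_distr[of h1 h2 "frag_of (b, c)"] that by simp
    then show ?case
      using generate.eng[OF eng.IH] by simp
  qed
  have "x \<otimes>\<^bsub>Z\<^esub> r \<in> I" if "r \<in> I" "Poly_Mapping.keys x \<subseteq> carrier B \<times> carrier C" for x r
    using that(2)
  proof (induction x rule: frag_induction)
    case zero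
    show ?case
      using subgroup.one_closed[OF tensor_kernel_subgroup] by (simp add: int_monoid_ring_mult)
  next
    case (one k)
    then show ?case
      using pure that by (cases k) auto
  next
    case (diff x y)
    then show ?case
      by (simp add: int_monoid_ring_mult I_diff)
  qed
  then have l: "x \<otimes>\<^bsub>Z\<^esub> r \<in> I" if "r \<in> I" "x \<in> carrier Z" for x r
    using that by (simp add: DirProd_def)
  moreover have "r \<otimes>\<^bsub>Z\<^esub> x \<in> I" if "r \<in> I" "x \<in> carrier Z" for x r
    using l[OF that] Z.m_comm I_keys[of r] that by (metis carrier_DirProd int_monoid_ring_simps(1))
  ultimately show ?thesis
    by (intro idealI Z.ring_axioms tensor_kernel_subgroup)
qed

sublocale I: ideal I Z
  by (rule ideal_tensor_kernel)
lemma cring_T: "cring T"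
  unfolding tensor_ring_def by (rule I.quotient_is_cring[OF Z.cring_axioms])

sublocale T: cring T
  by (rule cring_T)

section \<open>Cosets and pure tensors\<close>

lemma T_carrier: "X \<in> carrier T \<longleftrightarrow> (\<exists>x. Poly_Mapping.keys x \<subseteq> carrier B \<times> carrier C \<and> X = I +>\<^bsub>Z\<^esub> x)"
proof -
  have "carrier T = (\<Union>x\<in>carrier Z. {I +>\<^bsub>Z\<^esub> x})"
    by (simp add: tensor_ring_def FactRing_def A_RCOSETS_def')
  then show ?thesis
    by (simp only: UN_iff singleton_iff int_monoid_ring_simps carrier_DirProd Bex_def)
qed

lemma coset_closed: "Poly_Mapping.keys x \<subseteq> carrier B \<times> carrier C \<Longrightarrow> I +>\<^bsub>Z\<^esub> x \<in> carrier T"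
  unfolding T_carrier by blast

lemma coset_zero: "I +>\<^bsub>Z\<^esub> 0 = \<zero>\<^bsub>T\<^esub>"
  using Z.a_coset_add_zero[OF I.a_subset] by (simp add: tensor_ring_def FactRing_def)

lemma T_ops:
  assumes "Poly_Mapping.keys x \<subseteq> carrier B \<times> carrier C" "Poly_Mapping.keys y \<subseteq> carrier B \<times> carrier C"
  shows "(I +>\<^bsub>Z\<^esub> x) \<oplus>\<^bsub>T\<^esub> (I +>\<^bsub>Z\<^esub> y) = I +>\<^bsub>Z\<^esub> (x + y)"
    and "(I +>\<^bsub>Z\<^esub> x) \<otimes>\<^bsub>T\<^esub> (I +>\<^bsub>Z\<^esub> y) = I +>\<^bsub>Z\<^esub> (x \<otimes>\<^bsub>Z\<^esub> y)"
  using assms ring_hom_add[OF I.rcos_ring_hom, of x y] ring_hom_mult[OF I.rcos_ring_hom, of x y]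
  by (simp_all add: tensor_ring_def)

lemma coset_eqI:
  assumes "Poly_Mapping.keys x \<subseteq> carrier B \<times> carrier C" "Poly_Mapping.keys y \<subseteq> carrier B \<times> carrier C"
    "x - y \<in> I"
  shows "I +>\<^bsub>Z\<^esub> x = I +>\<^bsub>Z\<^esub> y"
  using Z.quotient_eq_iff_same_a_r_cos[OF ideal_tensor_kernel, of x y] assms
  by (simp add: a_minus_def int_monoid_ring_minus)

lemma relator_in_I: "x \<in> tensor_relators A B C f g \<Longrightarrow> x \<in> I"
  by (simp add: tensor_kernel_def generate.incl)

lemma t_closed [simp, intro]: "b \<in> carrier B \<Longrightarrow> c \<in> carrier C \<Longrightarrow> t b c \<in> carrier T"
  by (simp add: tensor_elem_def coset_closed)

lemma t_add_left:
  assumes "b \<in> carrier B" "b' \<in> carrier B" "c \<in> carrier C"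
  shows "t (b \<oplus>\<^bsub>B\<^esub> b') c = t b c \<oplus>\<^bsub>T\<^esub> t b' c"
proof -
  have "frag_of (b \<oplus>\<^bsub>B\<^esub> b', c) - (frag_of (b, c) + frag_of (b', c)) \<in> I"
    using assms tensor_relatorsI by (intro relator_in_I) (simp add: diff_diff_eq[symmetric])
  moreover have "Poly_Mapping.keys (frag_of (b, c) + frag_of (b', c)) \<subseteq> carrier B \<times> carrier C"
    using assms keys_add[of "frag_of (b, c)" "frag_of (b', c)"] by auto
  ultimately show ?thesis
    using assms by (simp add: tensor_elem_def T_ops coset_eqI)
qed

lemma t_add_right:
  assumes "b \<in> carrier B" "c \<in> carrier C" "c' \<in> carrier C"
  shows "t b (c \<oplus>\<^bsub>C\<^esub> c') = t b c \<oplus>\<^bsub>T\<^esub> t b c'"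
proof -
  have "frag_of (b, c \<oplus>\<^bsub>C\<^esub> c') - (frag_of (b, c) + frag_of (b, c')) \<in> I"
    using assms tensor_relatorsI by (intro relator_in_I) (simp add: diff_diff_eq[symmetric])
  moreover have "Poly_Mapping.keys (frag_of (b, c) + frag_of (b, c')) \<subseteq> carrier B \<times> carrier C"
    using assms keys_add[of "frag_of (b, c)" "frag_of (b, c')"] by auto
  ultimately show ?thesis
    using assms by (simp add: tensor_elem_def T_ops coset_eqI)
qed

lemma t_balanced:
  assumes "a \<in> carrier A" "b \<in> carrier B" "c \<in> carrier C"
  shows "t (f a \<otimes>\<^bsub>B\<^esub> b) c = t b (g a \<otimes>\<^bsub>C\<^esub> c)"
proof -
  have "frag_of (f a \<otimes>\<^bsub>B\<^esub> b, c) - frag_of (b, g a \<otimes>\<^bsub>C\<^esub> c) \<in> I"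
    using assms by (intro relator_in_I tensor_relatorsI)
  then show ?thesis
    using assms f_closed g_closed by (simp add: tensor_elem_def coset_eqI)
qed

lemma t_mult:
  assumes "b \<in> carrier B" "b' \<in> carrier B" "c \<in> carrier C" "c' \<in> carrier C"
  shows "t b c \<otimes>\<^bsub>T\<^esub> t b' c' = t (b \<otimes>\<^bsub>B\<^esub> b') (c \<otimes>\<^bsub>C\<^esub> c')"
  using assms by (simp add: tensor_elem_def T_ops int_monoid_ring_mult)

lemma t_one: "\<one>\<^bsub>T\<^esub> = t \<one>\<^bsub>B\<^esub> \<one>\<^bsub>C\<^esub>"
  by (simp add: tensor_elem_def tensor_ring_def FactRing_def DirProd_def)

lemma t_zero_left: "c \<in> carrier C \<Longrightarrow> t \<zero>\<^bsub>B\<^esub> c = \<zero>\<^bsub>T\<^esub>"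
  using t_add_left[of "\<zero>\<^bsub>B\<^esub>" "\<zero>\<^bsub>B\<^esub>" c] T.add.l_cancel_one'[of "t \<zero>\<^bsub>B\<^esub> c" "t \<zero>\<^bsub>B\<^esub> c"]
  by auto

text \<open>There is no case for negatives: -(b (x) c) = (-b) (x) c is again pure, so every element
  is a sum of pure tensors.\<close>

lemma tensor_induct [consumes 1, case_names pure add]:
  assumes "X \<in> carrier T"
    and pure: "\<And>b c. b \<in> carrier B \<Longrightarrow> c \<in> carrier C \<Longrightarrow> P (t b c)"
    and add: "\<And>X Y. X \<in> carrier T \<Longrightarrow> Y \<in> carrier T \<Longrightarrow> P X \<Longrightarrow> P Y \<Longrightarrow> P (X \<oplus>\<^bsub>T\<^esub> Y)"
  shows "P X"
proof -
  obtain x where x: "Poly_Mapping.keys x \<subseteq> carrier B \<times> carrier C" "X = I +>\<^bsub>Z\<^esub> x"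
    using assms(1) unfolding T_carrier by blast
  \<comment> \<open>The property is proved for x and -x together, because formal combinations are
    built by differences while \<open>P\<close> is only known to pass to sums.\<close>
  have "P (I +>\<^bsub>Z\<^esub> x) \<and> P (I +>\<^bsub>Z\<^esub> (- x))"
    using x(1)
  proof (induction x rule: free_Abelian_group_induct[consumes 1, case_names zero diff one])
    case zero
    have "P (t \<zero>\<^bsub>B\<^esub> \<zero>\<^bsub>C\<^esub>)"
      by (simp add: pure)
    moreover have "I +>\<^bsub>Z\<^esub> 0 = t \<zero>\<^bsub>B\<^esub> \<zero>\<^bsub>C\<^esub>"
      by (simp add: t_zero_left coset_zero)
    ultimately show ?case by simp
  next
    case (diff x y)
    then have neg: "Poly_Mapping.keys (- x) \<subseteq> carrier B \<times> carrier C"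
      "Poly_Mapping.keys (- y) \<subseteq> carrier B \<times> carrier C"
      by (simp_all add: keys_minus)
    have "I +>\<^bsub>Z\<^esub> (x - y) = (I +>\<^bsub>Z\<^esub> x) \<oplus>\<^bsub>T\<^esub> (I +>\<^bsub>Z\<^esub> (- y))"
      "I +>\<^bsub>Z\<^esub> (- (x - y)) = (I +>\<^bsub>Z\<^esub> y) \<oplus>\<^bsub>T\<^esub> (I +>\<^bsub>Z\<^esub> (- x))"
      using diff neg by (simp_all add: T_ops)
    then show ?case
      using diff neg add[of "I +>\<^bsub>Z\<^esub> x" "I +>\<^bsub>Z\<^esub> (- y)"] add[of "I +>\<^bsub>Z\<^esub> y" "I +>\<^bsub>Z\<^esub> (- x)"] coset_closed by simp
  next
    case (one k)
    obtain b c where k: "k = (b, c)" "b \<in> carrier B" "c \<in> carrier C"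
      using one by blast
    have "t (\<ominus>\<^bsub>B\<^esub> b) c \<oplus>\<^bsub>T\<^esub> t b c = \<zero>\<^bsub>T\<^esub>"
      using k t_add_left[of "\<ominus>\<^bsub>B\<^esub> b" b c] by (simp add: B.l_neg t_zero_left)
    then have "t (\<ominus>\<^bsub>B\<^esub> b) c = \<ominus>\<^bsub>T\<^esub> t b c"
      using k by (intro T.minus_equality[symmetric]) auto
    moreover have "(I +>\<^bsub>Z\<^esub> (- frag_of k)) \<oplus>\<^bsub>T\<^esub> t b c = \<zero>\<^bsub>T\<^esub>"
      using k by (simp add: tensor_elem_def T_ops keys_minus flip: coset_zero)
    then have "I +>\<^bsub>Z\<^esub> (- frag_of k) = \<ominus>\<^bsub>T\<^esub> t b c"
      using k by (intro T.minus_equality[symmetric]) (simp_all add: coset_closed keys_minus)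
    ultimately show ?case
      using pure[of b c] pure[of "\<ominus>\<^bsub>B\<^esub> b" c] k by (simp add: tensor_elem_def)
  qed
  then show ?thesis using x by simp
qed

text \<open>This is the universal property. The additive extension \<open>F\<close> of
  \<open>h\<close> to formal combinations vanishes on the relators, hence on the ideal, hence is
  constant on cosets. The image of a coset under \<open>F\<close> is then a singleton, and
  \<open>the_elem\<close> in \<open>tensor_lift\<close> reads off its value.\<close>

lemma
  fixes P :: "('p, 'w) ring_scheme" and h :: "'b \<Rightarrow> 'c \<Rightarrow> 'p"
  assumes P: "abelian_group P"
    and closed: "\<And>b c. b \<in> carrier B \<Longrightarrow> c \<in> carrier C \<Longrightarrow> h b c \<in> carrier P"
    and left: "\<And>b b' c. b \<in> carrier B \<Longrightarrow> b' \<in> carrier B \<Longrightarrow> c \<in> carrier C \<Longrightarrow>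
      h (b \<oplus>\<^bsub>B\<^esub> b') c = h b c \<oplus>\<^bsub>P\<^esub> h b' c"
    and right: "\<And>b c c'. b \<in> carrier B \<Longrightarrow> c \<in> carrier C \<Longrightarrow> c' \<in> carrier C \<Longrightarrow>
      h b (c \<oplus>\<^bsub>C\<^esub> c') = h b c \<oplus>\<^bsub>P\<^esub> h b c'"
    and balanced: "\<And>a b c. a \<in> carrier A \<Longrightarrow> b \<in> carrier B \<Longrightarrow> c \<in> carrier C \<Longrightarrow>
      h (f a \<otimes>\<^bsub>B\<^esub> b) c = h b (g a \<otimes>\<^bsub>C\<^esub> c)"
  shows tensor_lift_pure: "\<And>b c. b \<in> carrier B \<Longrightarrow> c \<in> carrier C \<Longrightarrow> tensor_lift P h (t b c) = h b c"
    and tensor_lift_add: "\<And>X Y. X \<in> carrier T \<Longrightarrow> Y \<in> carrier T \<Longrightarrow>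
      tensor_lift P h (X \<oplus>\<^bsub>T\<^esub> Y) = tensor_lift P h X \<oplus>\<^bsub>P\<^esub> tensor_lift P h Y"
    and tensor_lift_closed: "\<And>X. X \<in> carrier T \<Longrightarrow> tensor_lift P h X \<in> carrier P"
proof -
  interpret P: abelian_group P by fact
  let ?K = "carrier B \<times> carrier C"
  let ?h = "\<lambda>k. h (fst k) (snd k)"
  define F where "F x = (\<Oplus>\<^bsub>P\<^esub>k\<in>Poly_Mapping.keys x. [Poly_Mapping.lookup x k] \<cdot>\<^bsub>P\<^esub> ?h k)"
    for x :: "'b \<times> 'c \<Rightarrow>\<^sub>0 int"
  have hK: "k \<in> ?K \<Longrightarrow> ?h k \<in> carrier P" for k
    using closed by auto
  have F_add: "F (x + y) = F x \<oplus>\<^bsub>P\<^esub> F y"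
    if "Poly_Mapping.keys x \<subseteq> ?K" "Poly_Mapping.keys y \<subseteq> ?K" for x y
    unfolding F_def by (rule finsum_frag_add[OF P hK that])
  have F_closed: "F x \<in> carrier P" if "Poly_Mapping.keys x \<subseteq> ?K" for x
    unfolding F_def using that hK by (intro P.finsum_closed Pi_I P.add.int_pow_closed) blast
  have F_of: "F (frag_of k) = ?h k" if "k \<in> ?K" for k
    using hK[OF that] by (simp add: F_def P.add.int_pow_1)
  have F_zero: "F 0 = \<zero>\<^bsub>P\<^esub>"
    by (simp add: F_def)
  have F_uminus: "F (- x) = \<ominus>\<^bsub>P\<^esub> F x" if "Poly_Mapping.keys x \<subseteq> ?K" for x
    using F_add[of "- x" x] that F_closed[of x] F_closed[of "- x"]
    by (intro P.minus_equality[symmetric]) (auto simp: F_zero keys_minus)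
  have F_diff: "F (x - y) = F x \<ominus>\<^bsub>P\<^esub> F y"
    if "Poly_Mapping.keys x \<subseteq> ?K" "Poly_Mapping.keys y \<subseteq> ?K" for x y
    using F_add[of x "- y"] F_uminus[of y] that by (simp add: keys_minus a_minus_def)
  have keys_diff': "Poly_Mapping.keys (x - y) \<subseteq> ?K"
    if "Poly_Mapping.keys x \<subseteq> ?K" "Poly_Mapping.keys y \<subseteq> ?K" for x y :: "'b \<times> 'c \<Rightarrow>\<^sub>0 int"
    using that keys_diff[of x y] by blast
  \<comment> \<open>Each kind of relator is sent to zero by one of the assumptions on
    \<open>h\<close>: additivity on the left, additivity on the right, or balancing.\<close>
  have F_rel: "F x = \<zero>\<^bsub>P\<^esub>" if "x \<in> tensor_relators A B C f g" for x
    using that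
  proof (cases rule: tensor_relatorsE)
    case (left b b' c)
    then show ?thesis
      using closed assms(3) by (simp add: F_diff keys_diff' F_of P.minus_eq P.a_ac P.r_neg P.r_neg1)
  next
    case (right b c c')
    then show ?thesis
      using closed assms(4) by (simp add: F_diff keys_diff' F_of P.minus_eq P.a_ac P.r_neg P.r_neg1)
  next
    case (balanced a b c)
    then show ?thesis
      using closed assms(5) f_closed g_closed by (simp add: F_diff F_of P.minus_eq P.r_neg)
  qed
  have F_I: "F x = \<zero>\<^bsub>P\<^esub>" if "x \<in> I" for x
    using that unfolding tensor_kernel_def
  proof (induction rule: generate.induct)
    case (inv x)
    then show ?case
      using tensor_relators_keys[of x] by (simp add: F_uminus F_rel)
  next
    case (eng x y)
    then have "x \<in> I" "y \<in> I" by (simp_all add: tensor_kernel_def)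
    then show ?case
      using eng I_keys by (simp add: F_add)
  qed (simp_all add: F_zero F_rel)
  have lift: "tensor_lift P h (I +>\<^bsub>Z\<^esub> x) = F x" if "Poly_Mapping.keys x \<subseteq> ?K" for x
  proof -
    have const: "F y = F x" if y: "y \<in> I +>\<^bsub>Z\<^esub> x" for y
    proof -
      obtain i where "i \<in> I" "y = i + x"
        using y unfolding a_r_coset_def' int_monoid_ring_simps by blast
      then show ?thesis
        using \<open>Poly_Mapping.keys x \<subseteq> ?K\<close> by (simp add: F_add I_keys F_I F_closed)
    qed
    have self: "x \<in> I +>\<^bsub>Z\<^esub> x"
      using that by (intro I.a_rcos_self) simp
    have "F ` (I +>\<^bsub>Z\<^esub> x) = {F x}"
      by (rule equalityI[OF image_subsetI]) (simp_all only: const singletonI insert_subset imageI[OF self] empty_subsetI)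
    then show ?thesis
      unfolding tensor_lift_def F_def[symmetric] by simp
  qed
  show "tensor_lift P h (t b c) = h b c" if "b \<in> carrier B" "c \<in> carrier C" for b c
    using that by (simp add: tensor_elem_def lift F_of)
  show "tensor_lift P h X \<in> carrier P" if "X \<in> carrier T" for X
    using that unfolding T_carrier by (auto simp: lift F_closed)
  show "tensor_lift P h (X \<oplus>\<^bsub>T\<^esub> Y) = tensor_lift P h X \<oplus>\<^bsub>P\<^esub> tensor_lift P h Y"
    if XY: "X \<in> carrier T" "Y \<in> carrier T" for X Y
  proof -
    obtain x y where "Poly_Mapping.keys x \<subseteq> ?K" "X = I +>\<^bsub>Z\<^esub> x"
      "Poly_Mapping.keys y \<subseteq> ?K" "Y = I +>\<^bsub>Z\<^esub> y"
      using XY unfolding T_carrier by blast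
    moreover have "Poly_Mapping.keys (x + y) \<subseteq> ?K"
      using calculation keys_add[of x y] by blast
    ultimately show ?thesis
      by (simp add: T_ops lift F_add)
  qed
qed

end

section \<open>The algebra $Q$\<close>

text \<open>Stated for bare functions, since the maps produced by \<open>tensor_lift\<close> come
  with closedness and additivity alone.\<close>

lemma
  assumes "abelian_group G" "abelian_group H"
    and closed: "\<And>x. x \<in> carrier G \<Longrightarrow> h x \<in> carrier H"
    and add: "\<And>x y. x \<in> carrier G \<Longrightarrow> y \<in> carrier G \<Longrightarrow> h (x \<oplus>\<^bsub>G\<^esub> y) = h x \<oplus>\<^bsub>H\<^esub> h y"
  shows additive_zero: "h \<zero>\<^bsub>G\<^esub> = \<zero>\<^bsub>H\<^esub>"
    and additive_uminus: "x \<in> carrier G \<Longrightarrow> h (\<ominus>\<^bsub>G\<^esub> x) = \<ominus>\<^bsub>H\<^esub> h x"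
proof -
  interpret G: abelian_group G by fact
  interpret H: abelian_group H by fact
  show z: "h \<zero>\<^bsub>G\<^esub> = \<zero>\<^bsub>H\<^esub>"
    using add[of "\<zero>\<^bsub>G\<^esub>" "\<zero>\<^bsub>G\<^esub>"] H.add.l_cancel_one'[of "h \<zero>\<^bsub>G\<^esub>" "h \<zero>\<^bsub>G\<^esub>"] closed by simp
  show "h (\<ominus>\<^bsub>G\<^esub> x) = \<ominus>\<^bsub>H\<^esub> h x" if "x \<in> carrier G"
    using add[of "\<ominus>\<^bsub>G\<^esub> x" x] that closed
    by (intro H.minus_equality[symmetric]) (auto simp: z G.l_neg)
qed

locale ring_extension = ring_hom_cring R S \<phi>
  for R :: "('r, 'p) ring_scheme" and S :: "('s, 'q) ring_scheme" and \<phi> :: "'r \<Rightarrow> 's"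
begin

abbreviation SS where "SS \<equiv> SS_ring R S \<phi>"
abbreviation e where "e \<equiv> SS_elem R S \<phi>"
abbreviation D where "D \<equiv> Delta R S \<phi>"
abbreviation QR where "QR \<equiv> Q_ring R S \<phi>"
abbreviation QM where "QM \<equiv> Q_module R S \<phi>"

sublocale SS: tensor_product R S S \<phi> \<phi>
  by unfold_locales auto

lemmas SS_cring = SS.T.cring_axioms[folded SS_ring_def]
lemmas e_closed [simp] = SS.t_closed[folded SS_ring_def SS_elem_def]
lemmas e_mult = SS.t_mult[folded SS_ring_def SS_elem_def]
lemmas e_add_left = SS.t_add_left[folded SS_ring_def SS_elem_def]
lemmas e_add_right = SS.t_add_right[folded SS_ring_def SS_elem_def]
lemmas e_balanced = SS.t_balanced[folded SS_ring_def SS_elem_def]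
lemmas e_one = SS.t_one[folded SS_ring_def SS_elem_def]
lemmas SS_induct [consumes 1, case_names pure add] =
  SS.tensor_induct[folded SS_ring_def SS_elem_def]

section \<open>The multiplication map of S (x)_R S and the span Delta\<close>

lemma
  shows SS_mult_pure [simp]: "x \<in> carrier S \<Longrightarrow> y \<in> carrier S \<Longrightarrow> SS_mult S (e x y) = x \<otimes>\<^bsub>S\<^esub> y"
    and SS_mult_add: "X \<in> carrier SS \<Longrightarrow> Y \<in> carrier SS \<Longrightarrow>
      SS_mult S (X \<oplus>\<^bsub>SS\<^esub> Y) = SS_mult S X \<oplus>\<^bsub>S\<^esub> SS_mult S Y"
    and SS_mult_closed [simp]: "X \<in> carrier SS \<Longrightarrow> SS_mult S X \<in> carrier S"
  unfolding SS_mult_def SS_ring_def SS_elem_def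
  by (simp_all add: SS.tensor_lift_pure SS.tensor_lift_add SS.tensor_lift_closed
      S.is_abelian_group S.l_distr S.r_distr S.m_ac)

text \<open>Both sides are additive in \<open>X\<close> and in \<open>Y\<close>, and on pure tensors
  the claim is commutativity of \<open>S\<close>. Applied to a factor from \<open>Delta\<close>, it
  is what balances the augmentation of Q.\<close>

lemma SS_mult_mult:
  assumes "X \<in> carrier SS" "Y \<in> carrier SS"
  shows "SS_mult S (X \<otimes>\<^bsub>SS\<^esub> Y) = SS_mult S X \<otimes>\<^bsub>S\<^esub> SS_mult S Y"
proof -
  interpret SS: cring SS by (rule SS_cring)
  show ?thesis
    using assms(1)
  proof (induction X rule: SS_induct)
    case (pure x y)
    show ?case
      using assms(2)
      by (induction Y rule: SS_induct)
        (use pure in \<open>simp_all add: e_mult S.m_ac SS_mult_add SS.r_distr S.r_distr\<close>)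
  next
    case (add X X')
    then show ?case
      using assms(2) by (simp add: SS_mult_add SS.l_distr S.l_distr)
  qed
qed

lemma D_gen: "r \<in> carrier R \<Longrightarrow> s \<in> carrier S \<Longrightarrow> e (\<phi> r \<otimes>\<^bsub>S\<^esub> s) s \<in> carrier D"
  by (auto simp: Delta_def intro!: generate.incl)

lemma D_subset: "carrier D \<subseteq> carrier SS"
proof -
  interpret SS: cring SS by (rule SS_cring)
  have "generate (add_monoid SS) {e (\<phi> r \<otimes>\<^bsub>S\<^esub> s) s | r s. r \<in> carrier R \<and> s \<in> carrier S}
    \<subseteq> carrier (add_monoid SS)"
    by (rule group.generate_incl[OF SS.a_group]) auto
  then show ?thesis
    by (simp add: Delta_def)
qed

sublocale Q: tensor_product D SS S "\<lambda>d. d" "SS_mult S"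
  unfolding tensor_product_def tensor_product_axioms_def
  using SS_cring S.cring_axioms D_subset by auto

abbreviation qe where "qe \<equiv> Q_elem R S \<phi>"

lemmas Q_cring = Q.T.cring_axioms[folded Q_ring_def]
lemmas qe_closed [simp] = Q.t_closed[folded Q_ring_def Q_elem_def]
lemmas qe_mult = Q.t_mult[folded Q_ring_def Q_elem_def]
lemmas qe_add_left = Q.t_add_left[folded Q_ring_def Q_elem_def]
lemmas qe_add_right = Q.t_add_right[folded Q_ring_def Q_elem_def]
lemmas qe_balanced = Q.t_balanced[folded Q_ring_def Q_elem_def]
lemmas qe_one = Q.t_one[folded Q_ring_def Q_elem_def]
lemmas Q_tensor_induct [consumes 1, case_names pure add] =
  Q.tensor_induct[folded Q_ring_def Q_elem_def]

lemma QM_simps [simp]: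
  "carrier QM = carrier QR" "add QM = add QR" "ring.zero QM = ring.zero QR"
  "s \<odot>\<^bsub>QM\<^esub> X = qe (e \<one>\<^bsub>S\<^esub> \<one>\<^bsub>S\<^esub>) s \<otimes>\<^bsub>QR\<^esub> X"
  by (simp_all add: Q_module_def algebra_module_def)

text \<open>\<open>S\<close> acts through s |-> 1 (x) 1 (x) s, so the module laws are ring laws of Q
  together with additivity and multiplicativity of that map.\<close>

lemma QM_module: "module S QM"
proof -
  interpret Q: cring QR by (rule Q_cring)
  show ?thesis
  proof (rule moduleI)
    show "abelian_group QM"
    proof (rule abelian_groupI)
      show "\<exists>Y\<in>carrier QM. Y \<oplus>\<^bsub>QM\<^esub> X = \<zero>\<^bsub>QM\<^esub>" if "X \<in> carrier QM" for X
        using that Q.l_neg[of X] Q.a_inv_closed[of X] unfolding QM_simps by blast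
    qed (simp_all add: Q.a_ac)
  qed (use Q.B.one_closed in \<open>simp_all add: S.cring_axioms e_one[symmetric] qe_add_right Q.l_distr Q.r_distr
      qe_mult Q.m_assoc[symmetric] qe_one[symmetric]\<close>)
qed

lemma smult_qe [simp]:
  assumes "X \<in> carrier SS" "s \<in> carrier S" "t \<in> carrier S"
  shows "s \<odot>\<^bsub>QM\<^esub> qe X t = qe X (s \<otimes>\<^bsub>S\<^esub> t)"
proof -
  show ?thesis
    using assms by (simp add: qe_mult e_one[symmetric])
qed

text \<open>Since X (x) t = t (X (x) 1), the elements x (x) y (x) 1 generate Q over
  \<open>S\<close>. This is why a linear map h on Q is captured by the function x, y |-> h (x (x) y
  (x) 1).\<close>

lemma Q_induct [consumes 1, case_names smult add]:
  assumes "X \<in> carrier QR"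
    and "\<And>x y t. x \<in> carrier S \<Longrightarrow> y \<in> carrier S \<Longrightarrow> t \<in> carrier S \<Longrightarrow>
      P (t \<odot>\<^bsub>QM\<^esub> qe (e x y) \<one>\<^bsub>S\<^esub>)"
    and add: "\<And>X Y. X \<in> carrier QR \<Longrightarrow> Y \<in> carrier QR \<Longrightarrow> P X \<Longrightarrow> P Y \<Longrightarrow> P (X \<oplus>\<^bsub>QR\<^esub> Y)"
  shows "P X"
  using assms(1)
proof (induction X rule: Q_tensor_induct)
  case (pure b c)
  then show ?case
  proof (induction b rule: SS_induct)
    case (pure x y)
    then show ?case
      using assms(2)[of x y c] smult_qe[of "e x y" c "\<one>\<^bsub>S\<^esub>"] by simp
  next
    case (add X Y)
    then show ?case
      using assms(3) by (simp add: qe_add_left)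
  qed
qed (rule add)

subsection \<open>The augmentation\<close>

lemma
  shows Q_aug_pure: "x \<in> carrier SS \<Longrightarrow> t \<in> carrier S \<Longrightarrow> Q_aug S (qe x t) = SS_mult S x \<otimes>\<^bsub>S\<^esub> t"
    and Q_aug_add: "X \<in> carrier QR \<Longrightarrow> Y \<in> carrier QR \<Longrightarrow>
      Q_aug S (X \<oplus>\<^bsub>QR\<^esub> Y) = Q_aug S X \<oplus>\<^bsub>S\<^esub> Q_aug S Y"
    and Q_aug_closed [simp]: "X \<in> carrier QR \<Longrightarrow> Q_aug S X \<in> carrier S"
  using D_subset unfolding Q_aug_def Q_ring_def Q_elem_def
  by (simp_all add: Q.tensor_lift_pure Q.tensor_lift_add Q.tensor_lift_closed subset_iff
      S.is_abelian_group S.l_distr S.r_distr S.m_ac SS_mult_add SS_mult_mult)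

lemma Q_aug_smult:
  assumes "X \<in> carrier QR" "s \<in> carrier S"
  shows "Q_aug S (s \<odot>\<^bsub>QM\<^esub> X) = s \<otimes>\<^bsub>S\<^esub> Q_aug S X"
proof -
  interpret QM: module S QM by (rule QM_module)
  show ?thesis
    using assms(1)
  proof (induction X rule: Q_tensor_induct)
    case (pure X t)
    then show ?case
      using assms by (simp add: Q_aug_pure S.m_lcomm del: QM_simps)
  next
    case (add X Y)
    then show ?case
      using assms QM.smult_r_distr[of s X Y] QM.smult_closed[of s X] QM.smult_closed[of s Y]
      by (simp add: Q_aug_add S.r_distr del: QM_simps(4))
  qed
qed

end

section \<open>Polar forms and linear maps on $Q$\<close>

text \<open>Although pol_q is symmetric, the two arguments here run along different vectors of M, so
  symmetry is not part of the notion and R-homogeneity is listed for each argument.\<close>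

locale polar_form =
  fixes R :: "('r, 'p) ring_scheme" and S :: "('s, 'q) ring_scheme" and \<phi> :: "'r \<Rightarrow> 's"
    and N :: "('s, 'n, 'y) module_scheme" and \<beta> :: "'s \<Rightarrow> 's \<Rightarrow> 'n"
  assumes closed: "x \<in> carrier S \<Longrightarrow> y \<in> carrier S \<Longrightarrow> \<beta> x y \<in> carrier N"
    and add_left: "x \<in> carrier S \<Longrightarrow> x' \<in> carrier S \<Longrightarrow> y \<in> carrier S \<Longrightarrow>
      \<beta> (x \<oplus>\<^bsub>S\<^esub> x') y = \<beta> x y \<oplus>\<^bsub>N\<^esub> \<beta> x' y"
    and add_right: "x \<in> carrier S \<Longrightarrow> y \<in> carrier S \<Longrightarrow> y' \<in> carrier S \<Longrightarrow>
      \<beta> x (y \<oplus>\<^bsub>S\<^esub> y') = \<beta> x y \<oplus>\<^bsub>N\<^esub> \<beta> x y'"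
    and scale_left: "r \<in> carrier R \<Longrightarrow> x \<in> carrier S \<Longrightarrow> y \<in> carrier S \<Longrightarrow>
      \<beta> (\<phi> r \<otimes>\<^bsub>S\<^esub> x) y = \<phi> r \<odot>\<^bsub>N\<^esub> \<beta> x y"
    and scale_right: "r \<in> carrier R \<Longrightarrow> x \<in> carrier S \<Longrightarrow> y \<in> carrier S \<Longrightarrow>
      \<beta> x (\<phi> r \<otimes>\<^bsub>S\<^esub> y) = \<phi> r \<odot>\<^bsub>N\<^esub> \<beta> x y"
    and scale_both: "s \<in> carrier S \<Longrightarrow> x \<in> carrier S \<Longrightarrow> y \<in> carrier S \<Longrightarrow>
      \<beta> (s \<otimes>\<^bsub>S\<^esub> x) (s \<otimes>\<^bsub>S\<^esub> y) = (s \<otimes>\<^bsub>S\<^esub> s) \<odot>\<^bsub>N\<^esub> \<beta> x y"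

lemma linear_mapD:
  assumes "linear_map S M N f"
  shows "x \<in> carrier M \<Longrightarrow> f x \<in> carrier N"
    and "x \<in> carrier M \<Longrightarrow> y \<in> carrier M \<Longrightarrow> f (x \<oplus>\<^bsub>M\<^esub> y) = f x \<oplus>\<^bsub>N\<^esub> f y"
    and "s \<in> carrier S \<Longrightarrow> x \<in> carrier M \<Longrightarrow> f (s \<odot>\<^bsub>M\<^esub> x) = s \<odot>\<^bsub>N\<^esub> f x"
  using assms by (auto simp: linear_map_def)

lemma linear_mapI:
  assumes "\<And>x. x \<in> carrier M \<Longrightarrow> f x \<in> carrier N"
    and "\<And>x y. x \<in> carrier M \<Longrightarrow> y \<in> carrier M \<Longrightarrow> f (x \<oplus>\<^bsub>M\<^esub> y) = f x \<oplus>\<^bsub>N\<^esub> f y"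
    and "\<And>s x. s \<in> carrier S \<Longrightarrow> x \<in> carrier M \<Longrightarrow> f (s \<odot>\<^bsub>M\<^esub> x) = s \<odot>\<^bsub>N\<^esub> f x"
  shows "linear_map S M N f"
  using assms by (auto simp: linear_map_def)

lemma linear_map_compose:
  assumes "linear_map S L M f" "linear_map S M N g"
  shows "linear_map S L N (\<lambda>x. g (f x))"
  by (rule linear_mapI) (simp_all add: linear_mapD[OF assms(1)] linear_mapD[OF assms(2)])

locale ring_extension_module = ring_extension R S \<phi> + N: module S N
  for R :: "('r, 'p) ring_scheme" and S :: "('s, 'q) ring_scheme" and \<phi> :: "'r \<Rightarrow> 's"
    and N :: "('s, 'n, 'y) module_scheme"
begin

text \<open>The uniqueness half of the correspondence between forms and linear maps on Q; existence
  is \<open>linear_map_of_polar_form\<close>.\<close>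

lemma linear_map_Q_eqI:
  assumes h: "linear_map S QM N h" and h': "linear_map S QM N h'"
    and eq: "\<And>x y. x \<in> carrier S \<Longrightarrow> y \<in> carrier S \<Longrightarrow>
      h (qe (e x y) \<one>\<^bsub>S\<^esub>) = h' (qe (e x y) \<one>\<^bsub>S\<^esub>)"
    and X: "X \<in> carrier QR"
  shows "h X = h' X"
  using X
proof (induction X rule: Q_induct)
  case (smult x y t)
  then show ?case
    using linear_mapD(3)[OF h, of t "qe (e x y) \<one>\<^bsub>S\<^esub>"] linear_mapD(3)[OF h', of t "qe (e x y) \<one>\<^bsub>S\<^esub>"]
    by (simp add: eq del: QM_simps(4))
next
  case (add X Y)
  then show ?case
    using linear_mapD(2)[OF h, of X Y] linear_mapD(2)[OF h', of X Y] by simp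
qed

text \<open>An element of Delta crosses the outer tensor sign into \<open>S\<close>: phi(r) s (x) s
  acts on Q as the scalar phi(r) s^2. Taking s = 1 gives R-homogeneity, taking r = 1 gives the
  condition on (s x, s y).\<close>

lemma polar_form_of_linear_map:
  assumes h: "linear_map S QM N h"
  shows "polar_form R S \<phi> N (\<lambda>x y. h (qe (e x y) \<one>\<^bsub>S\<^esub>))"
proof -
  note h_add = linear_mapD(2)[OF h, simplified] and h_smult = linear_mapD(3)[OF h]
  have act: "h (qe (e (\<phi> r \<otimes>\<^bsub>S\<^esub> s \<otimes>\<^bsub>S\<^esub> x) (s \<otimes>\<^bsub>S\<^esub> y)) \<one>\<^bsub>S\<^esub>) =
      (\<phi> r \<otimes>\<^bsub>S\<^esub> s \<otimes>\<^bsub>S\<^esub> s) \<odot>\<^bsub>N\<^esub> h (qe (e x y) \<one>\<^bsub>S\<^esub>)"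
    if "r \<in> carrier R" "s \<in> carrier S" "x \<in> carrier S" "y \<in> carrier S" for r s x y
  proof -
    have "qe (e (\<phi> r \<otimes>\<^bsub>S\<^esub> s \<otimes>\<^bsub>S\<^esub> x) (s \<otimes>\<^bsub>S\<^esub> y)) \<one>\<^bsub>S\<^esub> =
        qe (e (\<phi> r \<otimes>\<^bsub>S\<^esub> s) s \<otimes>\<^bsub>SS\<^esub> e x y) \<one>\<^bsub>S\<^esub>"
      using that by (simp add: e_mult)
    also have "\<dots> = qe (e x y) (\<phi> r \<otimes>\<^bsub>S\<^esub> s \<otimes>\<^bsub>S\<^esub> s)"
      using that D_gen by (simp add: qe_balanced)
    also have "\<dots> = (\<phi> r \<otimes>\<^bsub>S\<^esub> s \<otimes>\<^bsub>S\<^esub> s) \<odot>\<^bsub>QM\<^esub> qe (e x y) \<one>\<^bsub>S\<^esub>"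
      using that by (simp del: QM_simps(4))
    finally show ?thesis
      using that by (simp add: h_smult del: QM_simps(4) smult_qe)
  qed
  show ?thesis
  proof
    fix r x y
    assume "r \<in> carrier R" "x \<in> carrier S" "y \<in> carrier S"
    then show "h (qe (e (\<phi> r \<otimes>\<^bsub>S\<^esub> x) y) \<one>\<^bsub>S\<^esub>) = \<phi> r \<odot>\<^bsub>N\<^esub> h (qe (e x y) \<one>\<^bsub>S\<^esub>)"
      using act[of r "\<one>\<^bsub>S\<^esub>" x y] by simp
    \<comment> \<open>The second argument inherits R-homogeneity from the first because
      \<open>e\<close> is balanced over \<open>R\<close>.\<close>
    then show "h (qe (e x (\<phi> r \<otimes>\<^bsub>S\<^esub> y)) \<one>\<^bsub>S\<^esub>) = \<phi> r \<odot>\<^bsub>N\<^esub> h (qe (e x y) \<one>\<^bsub>S\<^esub>)"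
      using \<open>r \<in> carrier R\<close> \<open>x \<in> carrier S\<close> \<open>y \<in> carrier S\<close> by (simp flip: e_balanced)
  next
    fix s x y
    assume "s \<in> carrier S" "x \<in> carrier S" "y \<in> carrier S"
    then show "h (qe (e (s \<otimes>\<^bsub>S\<^esub> x) (s \<otimes>\<^bsub>S\<^esub> y)) \<one>\<^bsub>S\<^esub>) =
        (s \<otimes>\<^bsub>S\<^esub> s) \<odot>\<^bsub>N\<^esub> h (qe (e x y) \<one>\<^bsub>S\<^esub>)"
      using act[of "\<one>\<^bsub>R\<^esub>" s x y] by simp
  qed (use linear_mapD(1)[OF h] h_add in \<open>simp_all add: e_add_left e_add_right qe_add_left\<close>)
qed

text \<open>The universal property is applied twice: beta extends to \<open>b\<close> on S (x)_R S,
  and X, t |-> t b(X) extends to \<open>h\<close> on Q. Balancing of the latter is b(d X) = mult(d)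
  b(X) for d in Delta.\<close>

lemma linear_map_of_polar_form:
  assumes "polar_form R S \<phi> N \<beta>"
  obtains h where "linear_map S QM N h"
    and "\<And>x y. x \<in> carrier S \<Longrightarrow> y \<in> carrier S \<Longrightarrow> h (qe (e x y) \<one>\<^bsub>S\<^esub>) = \<beta> x y"
proof -
  interpret \<beta>: polar_form R S \<phi> N \<beta> by fact
  interpret SS: cring SS by (rule SS_cring)
  have N: "abelian_group N"
    by (rule N.abelian_group_axioms)
  define b where "b = tensor_lift N \<beta>"
  have b_pure: "b (e x y) = \<beta> x y" if "x \<in> carrier S" "y \<in> carrier S" for x y
    unfolding b_def SS_elem_def using that
    by (simp add: SS.tensor_lift_pure[OF N] \<beta>.closed \<beta>.add_left \<beta>.add_right
        \<beta>.scale_left \<beta>.scale_right)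
  have b_closed: "b X \<in> carrier N" if "X \<in> carrier SS" for X
    unfolding b_def SS_elem_def using that[unfolded SS_ring_def]
    by (simp add: SS.tensor_lift_closed[OF N] \<beta>.closed \<beta>.add_left \<beta>.add_right
        \<beta>.scale_left \<beta>.scale_right)
  have b_add: "b (X \<oplus>\<^bsub>SS\<^esub> Y) = b X \<oplus>\<^bsub>N\<^esub> b Y" if "X \<in> carrier SS" "Y \<in> carrier SS" for X Y
    unfolding b_def SS_elem_def SS_ring_def using that[unfolded SS_ring_def]
    by (simp add: SS.tensor_lift_add[OF N] \<beta>.closed \<beta>.add_left \<beta>.add_right
        \<beta>.scale_left \<beta>.scale_right)
  have b_zero: "b \<zero>\<^bsub>SS\<^esub> = \<zero>\<^bsub>N\<^esub>"
    by (rule additive_zero[OF _ N, of SS]) (auto simp: b_closed b_add Q.B.abelian_group_axioms)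
  have b_uminus: "b (\<ominus>\<^bsub>SS\<^esub> X) = \<ominus>\<^bsub>N\<^esub> b X" if "X \<in> carrier SS" for X
    by (rule additive_uminus[OF _ N, of SS]) (auto simp: b_closed b_add that Q.B.abelian_group_axioms)
  have mult_uminus: "SS_mult S (\<ominus>\<^bsub>SS\<^esub> X) = \<ominus>\<^bsub>S\<^esub> SS_mult S X" if "X \<in> carrier SS" for X
    by (rule additive_uminus[of SS])
      (auto simp: SS_mult_add that Q.B.abelian_group_axioms S.abelian_group_axioms)
  have mult_zero: "SS_mult S \<zero>\<^bsub>SS\<^esub> = \<zero>\<^bsub>S\<^esub>"
    by (rule additive_zero[of SS])
      (auto simp: SS_mult_add Q.B.abelian_group_axioms S.abelian_group_axioms)
  \<comment> \<open>For d = phi(r) s (x) s, \<open>scale_left\<close> takes out phi(r) and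
    \<open>scale_both\<close> takes out s^2; together these make mult(d).\<close>
  have bal_gen: "b (e (\<phi> r \<otimes>\<^bsub>S\<^esub> s) s \<otimes>\<^bsub>SS\<^esub> X) = (\<phi> r \<otimes>\<^bsub>S\<^esub> s \<otimes>\<^bsub>S\<^esub> s) \<odot>\<^bsub>N\<^esub> b X"
    if "X \<in> carrier SS" and rs: "r \<in> carrier R" "s \<in> carrier S" for X r s
    using that(1)
  proof (induction X rule: SS_induct)
    case (pure x y)
    then have "b (e (\<phi> r \<otimes>\<^bsub>S\<^esub> s) s \<otimes>\<^bsub>SS\<^esub> e x y) = \<beta> (\<phi> r \<otimes>\<^bsub>S\<^esub> (s \<otimes>\<^bsub>S\<^esub> x)) (s \<otimes>\<^bsub>S\<^esub> y)"
      using rs by (simp add: e_mult b_pure S.m_assoc)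
    also have "\<dots> = (\<phi> r \<otimes>\<^bsub>S\<^esub> s \<otimes>\<^bsub>S\<^esub> s) \<odot>\<^bsub>N\<^esub> \<beta> x y"
      using rs pure
      by (simp add: \<beta>.scale_left \<beta>.scale_both \<beta>.closed S.m_assoc N.smult_assoc1)
    finally show ?case
      using pure by (simp add: b_pure)
  next
    case (add X Y)
    then show ?case
      using rs by (simp add: Q.B.r_distr b_add b_closed N.smult_r_distr)
  qed
  have bal: "b (d \<otimes>\<^bsub>SS\<^esub> X) = SS_mult S d \<odot>\<^bsub>N\<^esub> b X" if d: "d \<in> carrier D" and X: "X \<in> carrier SS" for d X
  proof -
    have "d \<in> generate (add_monoid SS)
        {e (\<phi> r \<otimes>\<^bsub>S\<^esub> s) s | r s. r \<in> carrier R \<and> s \<in> carrier S}"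
      using d by (simp add: Delta_def)
    \<comment> \<open>Membership in \<open>SS\<close> is carried along the induction because
      additivity of \<open>b\<close> and of the multiplication map is only available there.\<close>
    then have "d \<in> carrier SS \<and> b (d \<otimes>\<^bsub>SS\<^esub> X) = SS_mult S d \<odot>\<^bsub>N\<^esub> b X"
    proof (induction rule: generate.induct)
      case one
      then show ?case
        using X by (simp add: b_zero mult_zero b_closed)
    next
      case (incl d)
      then show ?case
        using X by (auto simp: bal_gen)
    next
      case (inv d)
      then have "d \<in> carrier SS" "b (d \<otimes>\<^bsub>SS\<^esub> X) = SS_mult S d \<odot>\<^bsub>N\<^esub> b X"
        using X by (auto simp: bal_gen)
      then have "\<ominus>\<^bsub>SS\<^esub> d \<in> carrier SS \<and> b (\<ominus>\<^bsub>SS\<^esub> d \<otimes>\<^bsub>SS\<^esub> X) = SS_mult S (\<ominus>\<^bsub>SS\<^esub> d) \<odot>\<^bsub>N\<^esub> b X"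
        using X by (simp add: Q.B.l_minus b_uminus mult_uminus b_closed N.smult_l_minus)
      then show ?case
        by (simp add: a_inv_def)
    next
      case (eng d d')
      then show ?case
        using X by (simp add: Q.B.l_distr b_add b_closed SS_mult_add N.smult_l_distr)
    qed
    then show ?thesis ..
  qed
  define h where "h = tensor_lift N (\<lambda>X t. t \<odot>\<^bsub>N\<^esub> b X)"
  have h_pure: "h (qe X t) = t \<odot>\<^bsub>N\<^esub> b X" if "X \<in> carrier SS" "t \<in> carrier S" for X t
    unfolding h_def Q_elem_def using that D_subset
    by (simp add: Q.tensor_lift_pure[OF N] b_closed b_add N.smult_r_distr N.smult_l_distr bal
        N.smult_assoc1[symmetric] S.m_comm subset_iff)
  have h_closed: "h X \<in> carrier N" if "X \<in> carrier QR" for X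
    unfolding h_def using that[unfolded Q_ring_def] D_subset
    by (simp add: Q.tensor_lift_closed[OF N] b_closed b_add N.smult_r_distr N.smult_l_distr bal
        N.smult_assoc1[symmetric] S.m_comm subset_iff)
  have h_add: "h (X \<oplus>\<^bsub>QR\<^esub> Y) = h X \<oplus>\<^bsub>N\<^esub> h Y" if "X \<in> carrier QR" "Y \<in> carrier QR" for X Y
    unfolding h_def Q_ring_def using that[unfolded Q_ring_def] D_subset
    by (simp add: Q.tensor_lift_add[OF N] b_closed b_add N.smult_r_distr N.smult_l_distr bal
        N.smult_assoc1[symmetric] S.m_comm subset_iff)
  interpret QM: module S QM by (rule QM_module)
  have h_smult: "h (s \<odot>\<^bsub>QM\<^esub> X) = s \<odot>\<^bsub>N\<^esub> h X" if "X \<in> carrier QR" and s: "s \<in> carrier S" for s X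
    using that(1)
  proof (induction X rule: Q_tensor_induct)
    case (pure X t)
    then show ?case
      using s by (simp add: h_pure b_closed N.smult_assoc1 del: QM_simps(4))
  next
    case (add X Y)
    then show ?case
      using s QM.smult_r_distr[of s X Y] QM.smult_closed[of s X] QM.smult_closed[of s Y]
      by (simp add: h_add h_closed N.smult_r_distr del: QM_simps(4))
  qed
  show thesis
  proof (rule that)
    show "linear_map S QM N h"
      by (rule linear_mapI) (simp_all add: h_closed h_add h_smult del: QM_simps(4))
    show "h (qe (e x y) \<one>\<^bsub>S\<^esub>) = \<beta> x y" if "x \<in> carrier S" "y \<in> carrier S" for x y
      using that by (simp add: h_pure b_pure \<beta>.closed)
  qed
qed

section \<open>Condition (c) in terms of forms\<close>

lemma aug_pullback_scalar_hom:
  assumes "n \<in> carrier N"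
  shows "aug_pullback R S \<phi> (scalar_hom S N n) = (\<lambda>X\<in>carrier QR. Q_aug S X \<odot>\<^bsub>N\<^esub> n)"
  by (auto simp: aug_pullback_def scalar_hom_def compose_def)

lemma linear_map_aug:
  assumes "n \<in> carrier N"
  shows "linear_map S QM N (\<lambda>X. Q_aug S X \<odot>\<^bsub>N\<^esub> n)"
  using assms
  by (intro linear_mapI)
    (simp_all add: Q_aug_add Q_aug_smult N.smult_l_distr N.smult_assoc1 del: QM_simps(4))

lemma QM_smult_closed:
  "s \<in> carrier S \<Longrightarrow> X \<in> carrier QR \<Longrightarrow> s \<odot>\<^bsub>QM\<^esub> X \<in> carrier QR"
  using module.smult_closed[OF QM_module, of s X] by simp

lemma QR_add_closed:
  "X \<in> carrier QR \<Longrightarrow> Y \<in> carrier QR \<Longrightarrow> X \<oplus>\<^bsub>QR\<^esub> Y \<in> carrier QR"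
  using Q_cring by (simp add: cring.cring_simprules)

text \<open>The pullback of n sends x (x) y (x) 1 to x y n, in particular 1 (x) 1 (x) 1 to n. It is
  therefore linear and injective in n for every N, and only surjectivity is at stake: every linear
  map on Q, hence every form, must have this shape.\<close>

lemma aug_pullback_iso_iff:
  "module_iso S N (Hom S QM N) (\<lambda>n. aug_pullback R S \<phi> (scalar_hom S N n)) \<longleftrightarrow>
    (\<forall>\<beta>. polar_form R S \<phi> N \<beta> \<longrightarrow>
      (\<forall>x\<in>carrier S. \<forall>y\<in>carrier S. \<beta> x y = (x \<otimes>\<^bsub>S\<^esub> y) \<odot>\<^bsub>N\<^esub> \<beta> \<one>\<^bsub>S\<^esub> \<one>\<^bsub>S\<^esub>))"
    (is "module_iso S N ?H ?f \<longleftrightarrow> ?P")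
proof
  assume iso: "module_iso S N ?H ?f"
  show ?P
  proof (intro allI impI ballI)
    fix \<beta> x y
    assume \<beta>: "polar_form R S \<phi> N \<beta>" and xy: "x \<in> carrier S" "y \<in> carrier S"
    obtain h where h: "linear_map S QM N h"
      and h\<beta>: "\<And>x y. x \<in> carrier S \<Longrightarrow> y \<in> carrier S \<Longrightarrow> h (qe (e x y) \<one>\<^bsub>S\<^esub>) = \<beta> x y"
      using linear_map_of_polar_form[OF \<beta>] by metis
    have "restrict h (carrier QR) \<in> carrier ?H"
      using linear_mapD[OF h] QR_add_closed
      by (auto simp: Hom_def pointwise_module_def QM_smult_closed
          intro!: linear_mapI simp del: QM_simps(4))
    then have "restrict h (carrier QR) \<in> ?f ` carrier N"
      using iso unfolding module_iso_def bij_betw_def by simp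
    then obtain n where n: "n \<in> carrier N" "restrict h (carrier QR) = ?f n"
      by blast
    have "\<beta> x y = (x \<otimes>\<^bsub>S\<^esub> y) \<odot>\<^bsub>N\<^esub> n" if "x \<in> carrier S" "y \<in> carrier S" for x y
      using fun_cong[OF n(2), of "qe (e x y) \<one>\<^bsub>S\<^esub>"] that n(1)
      by (simp add: aug_pullback_scalar_hom h\<beta> Q_aug_pure)
    \<comment> \<open>At x = y = 1 the formula just obtained gives n = beta(1, 1).\<close>
    then show "\<beta> x y = (x \<otimes>\<^bsub>S\<^esub> y) \<odot>\<^bsub>N\<^esub> \<beta> \<one>\<^bsub>S\<^esub> \<one>\<^bsub>S\<^esub>"
      using xy n by simp
  qed
next
  assume P: ?P
  have f: "?f n \<in> carrier ?H" if "n \<in> carrier N" for n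
    using that linear_mapD[OF linear_map_aug[OF that]] QR_add_closed
    by (auto simp: Hom_def pointwise_module_def aug_pullback_scalar_hom QM_smult_closed
        intro!: linear_mapI simp del: QM_simps(4))
  have "linear_map S N ?H ?f"
  proof (rule linear_mapI)
    show "?f (m \<oplus>\<^bsub>N\<^esub> n) = ?f m \<oplus>\<^bsub>?H\<^esub> ?f n" if "m \<in> carrier N" "n \<in> carrier N" for m n
      using that
      by (simp add: aug_pullback_scalar_hom Hom_def pointwise_module_def N.smult_r_distr
          cong: restrict_cong)
    show "?f (s \<odot>\<^bsub>N\<^esub> n) = s \<odot>\<^bsub>?H\<^esub> ?f n" if "s \<in> carrier S" "n \<in> carrier N" for s n
      using that
      by (simp add: aug_pullback_scalar_hom Hom_def pointwise_module_def S.m_comm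
          N.smult_assoc1[symmetric] cong: restrict_cong)
  qed (rule f)
  moreover have "inj_on ?f (carrier N)"
  proof (rule inj_onI)
    fix m n
    assume mn: "m \<in> carrier N" "n \<in> carrier N" "?f m = ?f n"
    show "m = n"
      using fun_cong[OF mn(3), of "qe (e \<one>\<^bsub>S\<^esub> \<one>\<^bsub>S\<^esub>) \<one>\<^bsub>S\<^esub>"] mn(1,2)
      by (simp add: aug_pullback_scalar_hom Q_aug_pure)
  qed
  moreover have "h \<in> ?f ` carrier N" if "h \<in> carrier ?H" for h
  proof -
    have h: "h \<in> extensional (carrier QR)" "linear_map S QM N h"
      using that by (auto simp: Hom_def pointwise_module_def PiE_def)
    define n where "n = h (qe (e \<one>\<^bsub>S\<^esub> \<one>\<^bsub>S\<^esub>) \<one>\<^bsub>S\<^esub>)"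
    have n: "n \<in> carrier N"
      unfolding n_def using linear_mapD(1)[OF h(2)] by simp
    have "h X = Q_aug S X \<odot>\<^bsub>N\<^esub> n" if "X \<in> carrier QR" for X
    proof (rule linear_map_Q_eqI[OF h(2) linear_map_aug[OF n] _ that])
      show "h (qe (e x y) \<one>\<^bsub>S\<^esub>) = Q_aug S (qe (e x y) \<one>\<^bsub>S\<^esub>) \<odot>\<^bsub>N\<^esub> n"
        if "x \<in> carrier S" "y \<in> carrier S" for x y
        using P[rule_format, OF polar_form_of_linear_map[OF h(2)] that] that
        by (simp add: n_def Q_aug_pure)
    qed
    then have "h = ?f n"
      using h(1) n by (auto simp: aug_pullback_scalar_hom fun_eq_iff extensional_def)
    then show ?thesis
      using n by blast
  qed
  ultimately show "module_iso S N ?H ?f"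
    unfolding module_iso_def bij_betw_def using f by blast
qed

subsection \<open>The augmentation kernel\<close>

abbreviation WM where "WM \<equiv> W_module R S \<phi>"
abbreviation unitQ where "unitQ \<equiv> qe (e \<one>\<^bsub>S\<^esub> \<one>\<^bsub>S\<^esub>) \<one>\<^bsub>S\<^esub>"

text \<open>The projection of Q onto W along S 1. On x (x) y (x) 1 it yields the element x (x) y (x)
  1 - x y 1 that enters the decomposition.\<close>

definition W_proj where "W_proj X = X \<ominus>\<^bsub>QR\<^esub> Q_aug S X \<odot>\<^bsub>QM\<^esub> unitQ"

lemma WM_simps [simp]:
  "X \<in> carrier WM \<longleftrightarrow> X \<in> carrier QR \<and> Q_aug S X = \<zero>\<^bsub>S\<^esub>"
  "add WM = add QR" "smult WM = smult QM"
  by (auto simp: W_module_def a_kernel_def' Q_module_def algebra_module_def)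

lemma linear_map_W_proj: "linear_map S QM WM W_proj"
proof -
  interpret QM: module S QM by (rule QM_module)
  interpret Q: cring QR by (rule Q_cring)
  have uminus: "Q_aug S (\<ominus>\<^bsub>QR\<^esub> X) = \<ominus>\<^bsub>S\<^esub> Q_aug S X" if "X \<in> carrier QR" for X
    by (rule additive_uminus[of QR])
      (auto simp: Q_aug_add that Q.abelian_group_axioms S.abelian_group_axioms)
  \<comment> \<open>The ring and the module Q share their addition, so their negatives agree. This
    makes the module laws applicable to a difference formed in the ring.\<close>
  have a_inv: "\<ominus>\<^bsub>QM\<^esub> X = \<ominus>\<^bsub>QR\<^esub> X" if "X \<in> carrier QR" for X
    using that QM.minus_equality[of "\<ominus>\<^bsub>QR\<^esub> X" X] by (simp add: Q.l_neg)
  show ?thesis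
  proof (rule linear_mapI)
    fix X
    assume "X \<in> carrier QM"
    then show "W_proj X \<in> carrier WM"
      by (simp add: W_proj_def a_minus_def QM_smult_closed uminus Q_aug_add Q_aug_smult Q_aug_pure
          S.r_neg del: QM_simps(4))
  next
    fix X Y
    assume XY: "X \<in> carrier QM" "Y \<in> carrier QM"
    let ?x = "Q_aug S X \<odot>\<^bsub>QM\<^esub> unitQ" and ?y = "Q_aug S Y \<odot>\<^bsub>QM\<^esub> unitQ"
    have "(Q_aug S X \<oplus>\<^bsub>S\<^esub> Q_aug S Y) \<odot>\<^bsub>QM\<^esub> unitQ = ?x \<oplus>\<^bsub>QR\<^esub> ?y"
      using XY QM.smult_l_distr[of "Q_aug S X" "Q_aug S Y" unitQ] by (simp del: QM_simps(4))
    moreover have "?x \<in> carrier QR" "?y \<in> carrier QR"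
      using XY by (simp_all add: QM_smult_closed del: QM_simps(4))
    ultimately show "W_proj (X \<oplus>\<^bsub>QM\<^esub> Y) = W_proj X \<oplus>\<^bsub>WM\<^esub> W_proj Y"
      using XY by (simp add: W_proj_def a_minus_def Q_aug_add Q.minus_add Q.a_ac del: QM_simps(4) smult_qe)
  next
    fix s X
    assume sX: "s \<in> carrier S" "X \<in> carrier QM"
    let ?x = "Q_aug S X \<odot>\<^bsub>QM\<^esub> unitQ"
    have x: "?x \<in> carrier QR"
      using sX by (simp add: QM_smult_closed del: QM_simps(4))
    have "s \<odot>\<^bsub>QM\<^esub> (X \<ominus>\<^bsub>QR\<^esub> ?x) = s \<odot>\<^bsub>QM\<^esub> X \<ominus>\<^bsub>QR\<^esub> s \<odot>\<^bsub>QM\<^esub> ?x"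
      using sX x QM.smult_r_distr[of s X "\<ominus>\<^bsub>QR\<^esub> ?x"] QM.smult_r_minus[of s ?x]
      by (simp add: a_minus_def a_inv QM_smult_closed del: QM_simps(4) smult_qe)
    then show "W_proj (s \<odot>\<^bsub>QM\<^esub> X) = s \<odot>\<^bsub>WM\<^esub> W_proj X"
      using sX QM.smult_assoc1[of s "Q_aug S X" unitQ]
      by (simp add: W_proj_def Q_aug_smult del: QM_simps(4) smult_qe)
  qed
qed

lemma W_proj_eq:
  assumes "X \<in> carrier WM"
  shows "W_proj X = X"
proof -
  interpret QM: module S QM by (rule QM_module)
  interpret Q: cring QR by (rule Q_cring)
  show ?thesis
    using assms QM.smult_l_null[of unitQ] by (simp add: W_proj_def a_minus_def del: QM_simps(4) smult_qe)
qed

text \<open>X is the sum of its W-part and of aug(X) 1, so a linear map on Q amounts to its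
  restriction to W and its value at 1. That value later becomes the coefficient of x y in the
  S-quadratic summand.\<close>

lemma W_proj_linear_restrict:
  assumes "linear_map S QM N h" "X \<in> carrier QR"
  shows "h (W_proj X) \<oplus>\<^bsub>N\<^esub> Q_aug S X \<odot>\<^bsub>N\<^esub> h unitQ = h X"
proof -
  interpret Q: cring QR by (rule Q_cring)
  let ?x = "Q_aug S X \<odot>\<^bsub>QM\<^esub> unitQ"
  have x: "?x \<in> carrier QR"
    using assms by (simp add: QM_smult_closed del: QM_simps(4))
  have "W_proj X \<in> carrier QR"
    using linear_mapD(1)[OF linear_map_W_proj, of X] assms by simp
  then have "h (W_proj X) \<oplus>\<^bsub>N\<^esub> h ?x = h (W_proj X \<oplus>\<^bsub>QR\<^esub> ?x)"
    using linear_mapD(2)[OF assms(1), of "W_proj X" ?x] x by simp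
  also have "W_proj X \<oplus>\<^bsub>QR\<^esub> ?x = X"
    using assms(2) x unfolding W_proj_def a_minus_def by (simp add: Q.a_assoc Q.l_neg del: QM_simps(4) smult_qe)
  finally show ?thesis
    using assms linear_mapD(3)[OF assms(1), of "Q_aug S X" unitQ] by (simp del: QM_simps(4) smult_qe)
qed

end

section \<open>Quadratic maps and polar forms\<close>

text \<open>The inverse of a linear bijection is linear as soon as sums and multiples of preimages
  stay in \<open>A\<close>. Closure is asked for directly because \<open>Quad\<close> and
  \<open>Hom\<close> are handled here as records with operations.\<close>

lemma isomorphic_modules_sym:
  assumes iso: "module_iso S A B f"
    and add: "\<And>x y. x \<in> carrier A \<Longrightarrow> y \<in> carrier A \<Longrightarrow> x \<oplus>\<^bsub>A\<^esub> y \<in> carrier A"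
    and smult: "\<And>s x. s \<in> carrier S \<Longrightarrow> x \<in> carrier A \<Longrightarrow> s \<odot>\<^bsub>A\<^esub> x \<in> carrier A"
  shows "isomorphic_modules S B A"
proof -
  have f: "linear_map S A B f" and bij: "bij_betw f (carrier A) (carrier B)"
    using iso by (auto simp: module_iso_def)
  define k where "k = inv_into (carrier A) f"
  have kf: "k (f x) = x" if "x \<in> carrier A" for x
    unfolding k_def using bij that by (rule bij_betw_inv_into_left)
  have fk: "f (k y) = y" "k y \<in> carrier A" if "y \<in> carrier B" for y
    unfolding k_def using bij that by (auto simp: bij_betw_inv_into_right bij_betw_def inv_into_into)
  have "linear_map S B A k"
  proof (rule linear_mapI)
    show "k (x \<oplus>\<^bsub>B\<^esub> y) = k x \<oplus>\<^bsub>A\<^esub> k y" if "x \<in> carrier B" "y \<in> carrier B" for x y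
      using kf[of "k x \<oplus>\<^bsub>A\<^esub> k y"] linear_mapD(2)[OF f, of "k x" "k y"] that fk add by simp
    show "k (s \<odot>\<^bsub>B\<^esub> x) = s \<odot>\<^bsub>A\<^esub> k x" if "s \<in> carrier S" "x \<in> carrier B" for s x
      using kf[of "s \<odot>\<^bsub>A\<^esub> k x"] linear_mapD(3)[OF f, of s "k x"] that fk smult by simp
  qed (rule fk)
  moreover have "bij_betw k (carrier B) (carrier A)"
    unfolding k_def by (rule bij_betw_inv_into[OF bij])
  ultimately show ?thesis
    unfolding isomorphic_modules_def module_iso_def by blast
qed

lemma restrict_scalars_simps [simp]:
  "carrier (restrict_scalars \<phi> M) = carrier M"
  "add (restrict_scalars \<phi> M) = add M"
  "r \<odot>\<^bsub>restrict_scalars \<phi> M\<^esub> m = \<phi> r \<odot>\<^bsub>M\<^esub> m"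
  by (simp_all add: restrict_scalars_def)

lemma Quad_simps [simp]:
  "q \<oplus>\<^bsub>Quad R S \<phi> M N\<^esub> q' = (\<lambda>m\<in>carrier M. q m \<oplus>\<^bsub>N\<^esub> q' m)"
  "s \<odot>\<^bsub>Quad R S \<phi> M N\<^esub> q = (\<lambda>m\<in>carrier M. s \<odot>\<^bsub>N\<^esub> q m)"
  by (simp_all add: Quad_def pointwise_module_def)

lemma Hom_simps [simp]:
  "f \<in> carrier (Hom S M N) \<longleftrightarrow> f \<in> extensional (carrier M) \<and> linear_map S M N f"
  "f \<oplus>\<^bsub>Hom S M N\<^esub> g = (\<lambda>m\<in>carrier M. f m \<oplus>\<^bsub>N\<^esub> g m)"
  "s \<odot>\<^bsub>Hom S M N\<^esub> f = (\<lambda>m\<in>carrier M. s \<odot>\<^bsub>N\<^esub> f m)"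
  by (auto simp: Hom_def pointwise_module_def PiE_def linear_map_def)

lemma direct_sum_simps [simp]:
  "carrier (direct_sum M N) = carrier M \<times> carrier N"
  "(m, n) \<oplus>\<^bsub>direct_sum M N\<^esub> (m', n') = (m \<oplus>\<^bsub>M\<^esub> m', n \<oplus>\<^bsub>N\<^esub> n')"
  "s \<odot>\<^bsub>direct_sum M N\<^esub> (m, n) = (s \<odot>\<^bsub>M\<^esub> m, s \<odot>\<^bsub>N\<^esub> n)"
  "\<zero>\<^bsub>direct_sum M N\<^esub> = (\<zero>\<^bsub>M\<^esub>, \<zero>\<^bsub>N\<^esub>)"
  by (simp_all add: direct_sum_def)

lemma self_module_simps [simp]:
  "carrier (self_module S) = carrier S"
  "add (self_module S) = add S"
  "smult (self_module S) = mult S"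
  "ring.zero (self_module S) = ring.zero S"
  by (simp_all add: algebra_module_def)

context ring_extension_module
begin

section \<open>Polarisation of maps on a general S-module\<close>

context
  fixes M :: "('s, 'm, 'z) module_scheme"
  assumes M: "module S M"
begin

interpretation M: module S M by (rule M)

text \<open>The last two claims trade the subtraction in \<open>pol\<close> for the equation q(x +
  y) = q x + q y + pol(x, y). Polar maps are afterwards identified by checking this equation, with
  no negatives involved.\<close>

lemma
  assumes q: "\<And>m. m \<in> carrier M \<Longrightarrow> q m \<in> carrier N"
    and "x \<in> carrier M" "y \<in> carrier M"
  shows pol_closed: "pol M N q x y \<in> carrier N"
    and pol_commute: "pol M N q x y = pol M N q y x"
    and pol_eqI: "\<And>b. b \<in> carrier N \<Longrightarrow> q (x \<oplus>\<^bsub>M\<^esub> y) = q x \<oplus>\<^bsub>N\<^esub> q y \<oplus>\<^bsub>N\<^esub> b \<Longrightarrow> pol M N q x y = b"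
    and pol_eq: "q (x \<oplus>\<^bsub>M\<^esub> y) = q x \<oplus>\<^bsub>N\<^esub> q y \<oplus>\<^bsub>N\<^esub> pol M N q x y"
proof -
  note c = q[OF assms(2)] q[OF assms(3)] q[OF M.a_closed[OF assms(2,3)]]
  show "pol M N q x y \<in> carrier N"
    using c by (simp add: pol_def)
  show "pol M N q x y = pol M N q y x"
    using c assms by (simp add: pol_def a_minus_def N.a_ac M.a_comm)
  have pol: "pol M N q x y = \<ominus>\<^bsub>N\<^esub> (q x \<oplus>\<^bsub>N\<^esub> q y) \<oplus>\<^bsub>N\<^esub> q (x \<oplus>\<^bsub>M\<^esub> y)"
    using c by (simp add: pol_def a_minus_def N.minus_add N.a_ac)
  show "pol M N q x y = b" if "b \<in> carrier N" "q (x \<oplus>\<^bsub>M\<^esub> y) = q x \<oplus>\<^bsub>N\<^esub> q y \<oplus>\<^bsub>N\<^esub> b" for b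
    unfolding pol that(2) using c that(1) by (intro N.r_neg1) auto
  show "q (x \<oplus>\<^bsub>M\<^esub> y) = q x \<oplus>\<^bsub>N\<^esub> q y \<oplus>\<^bsub>N\<^esub> pol M N q x y"
    unfolding pol using c by (intro N.r_neg2[symmetric]) auto
qed

text \<open>\<open>pol\<close> is symmetric, so linearity in the second argument gives linearity in
  the first.\<close>

lemma Quad_iff:
  "q \<in> carrier (Quad R S \<phi> M N) \<longleftrightarrow>
    q \<in> carrier M \<rightarrow>\<^sub>E carrier N \<and>
    (\<forall>s\<in>carrier S. \<forall>m\<in>carrier M. q (s \<odot>\<^bsub>M\<^esub> m) = (s \<otimes>\<^bsub>S\<^esub> s) \<odot>\<^bsub>N\<^esub> q m) \<and>
    (\<forall>x\<in>carrier M. \<forall>y\<in>carrier M. \<forall>z\<in>carrier M.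
      pol M N q x (y \<oplus>\<^bsub>M\<^esub> z) = pol M N q x y \<oplus>\<^bsub>N\<^esub> pol M N q x z) \<and>
    (\<forall>r\<in>carrier R. \<forall>x\<in>carrier M. \<forall>y\<in>carrier M.
      pol M N q x (\<phi> r \<odot>\<^bsub>M\<^esub> y) = \<phi> r \<odot>\<^bsub>N\<^esub> pol M N q x y)"
    (is "?l \<longleftrightarrow> ?e \<and> ?s \<and> ?a \<and> ?r")
proof
  assume ?l
  then show "?e \<and> ?s \<and> ?a \<and> ?r"
    by (simp add: Quad_def pointwise_module_def bilinear_map_def linear_map_def)
next
  assume r: "?e \<and> ?s \<and> ?a \<and> ?r"
  then have q: "m \<in> carrier M \<Longrightarrow> q m \<in> carrier N" for m
    by blast
  have lin: "linear_map R (restrict_scalars \<phi> M) (restrict_scalars \<phi> N) (pol M N q x)"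
    if "x \<in> carrier M" for x
    using r that by (intro linear_mapI) (simp_all add: pol_closed q)
  have "linear_map R (restrict_scalars \<phi> M) (restrict_scalars \<phi> N) (\<lambda>x. pol M N q x y)"
    if "y \<in> carrier M" for y
    using linear_mapD[OF lin[OF that]] that
    by (intro linear_mapI) (simp_all add: pol_commute[OF q _ that])
  with lin r show ?l
    by (simp add: Quad_def pointwise_module_def bilinear_map_def)
qed

text \<open>Biadditivity and R-homogeneity are those of \<open>pol\<close>, read along the lines
  through m and m'. The condition on (s x, s y) comes from q itself: all three terms of its
  polarisation scale by s^2.\<close>

lemma polar_form_pol:
  assumes Q: "q \<in> carrier (Quad R S \<phi> M N)" and m: "m \<in> carrier M" "m' \<in> carrier M"
  shows "polar_form R S \<phi> N (\<lambda>x y. pol M N q (x \<odot>\<^bsub>M\<^esub> m) (y \<odot>\<^bsub>M\<^esub> m'))"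
proof -
  have q: "m \<in> carrier M \<Longrightarrow> q m \<in> carrier N" for m
    using Q unfolding Quad_iff by blast
  have sq: "q (s \<odot>\<^bsub>M\<^esub> m) = (s \<otimes>\<^bsub>S\<^esub> s) \<odot>\<^bsub>N\<^esub> q m" if "s \<in> carrier S" "m \<in> carrier M" for s m
    using Q that unfolding Quad_iff by blast
  have right: "pol M N q x (y \<oplus>\<^bsub>M\<^esub> z) = pol M N q x y \<oplus>\<^bsub>N\<^esub> pol M N q x z"
    "r \<in> carrier R \<Longrightarrow> pol M N q x (\<phi> r \<odot>\<^bsub>M\<^esub> y) = \<phi> r \<odot>\<^bsub>N\<^esub> pol M N q x y"
    if "x \<in> carrier M" "y \<in> carrier M" "z \<in> carrier M" for x y z r
    using Q that unfolding Quad_iff by blast+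
  have left: "pol M N q (y \<oplus>\<^bsub>M\<^esub> z) x = pol M N q y x \<oplus>\<^bsub>N\<^esub> pol M N q z x"
    "r \<in> carrier R \<Longrightarrow> pol M N q (\<phi> r \<odot>\<^bsub>M\<^esub> y) x = \<phi> r \<odot>\<^bsub>N\<^esub> pol M N q y x"
    if "x \<in> carrier M" "y \<in> carrier M" "z \<in> carrier M" for x y z r
    using right[OF that] that by (simp_all add: pol_commute[OF q _ that(1)])
  have both: "pol M N q (s \<odot>\<^bsub>M\<^esub> x) (s \<odot>\<^bsub>M\<^esub> y) = (s \<otimes>\<^bsub>S\<^esub> s) \<odot>\<^bsub>N\<^esub> pol M N q x y"
    if "s \<in> carrier S" "x \<in> carrier M" "y \<in> carrier M" for s x y
  proof (rule pol_eqI[where q = q])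
    show "q (s \<odot>\<^bsub>M\<^esub> x \<oplus>\<^bsub>M\<^esub> s \<odot>\<^bsub>M\<^esub> y) =
        q (s \<odot>\<^bsub>M\<^esub> x) \<oplus>\<^bsub>N\<^esub> q (s \<odot>\<^bsub>M\<^esub> y) \<oplus>\<^bsub>N\<^esub> (s \<otimes>\<^bsub>S\<^esub> s) \<odot>\<^bsub>N\<^esub> pol M N q x y"
      using that q pol_eq[of q x y] pol_closed[of q x y]
      by (simp add: sq N.smult_r_distr flip: M.smult_r_distr)
  qed (use that q in \<open>simp_all add: pol_closed\<close>)
  show ?thesis
    using m
    by unfold_locales
      (simp_all add: pol_closed[OF q] M.smult_l_distr M.smult_assoc1 left right both)
qed

text \<open>Polarisation is additive in the map, so the conditions on \<open>pol\<close> add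
  up.\<close>

lemma Quad_add_closed:
  assumes "q \<in> carrier (Quad R S \<phi> M N)" "q' \<in> carrier (Quad R S \<phi> M N)"
  shows "q \<oplus>\<^bsub>Quad R S \<phi> M N\<^esub> q' \<in> carrier (Quad R S \<phi> M N)"
proof -
  note Q = assms(1)[unfolded Quad_iff] and Q' = assms(2)[unfolded Quad_iff]
  let ?q = "\<lambda>m\<in>carrier M. q m \<oplus>\<^bsub>N\<^esub> q' m"
  have q: "m \<in> carrier M \<Longrightarrow> q m \<in> carrier N" "m \<in> carrier M \<Longrightarrow> q' m \<in> carrier N" for m
    using Q Q' by blast+
  have p: "pol M N ?q x y = pol M N q x y \<oplus>\<^bsub>N\<^esub> pol M N q' x y"
    if "x \<in> carrier M" "y \<in> carrier M" for x y
    using that q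
    by (intro pol_eqI) (simp_all add: pol_closed pol_eq[of q x y] pol_eq[of q' x y] N.a_ac)
  show ?thesis
    unfolding Quad_iff Quad_simps using Q Q' q
    by (simp add: p pol_closed N.smult_r_distr N.a_ac)
qed

lemma Quad_smult_closed:
  assumes "q \<in> carrier (Quad R S \<phi> M N)" and t: "t \<in> carrier S"
  shows "t \<odot>\<^bsub>Quad R S \<phi> M N\<^esub> q \<in> carrier (Quad R S \<phi> M N)"
proof -
  note Q = assms(1)[unfolded Quad_iff]
  let ?q = "\<lambda>m\<in>carrier M. t \<odot>\<^bsub>N\<^esub> q m"
  have q: "m \<in> carrier M \<Longrightarrow> q m \<in> carrier N" for m
    using Q by blast
  have p: "pol M N ?q x y = t \<odot>\<^bsub>N\<^esub> pol M N q x y"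
    if "x \<in> carrier M" "y \<in> carrier M" for x y
    using that q t
    by (intro pol_eqI) (simp_all add: pol_closed pol_eq[of q x y] N.smult_r_distr)
  show ?thesis
    unfolding Quad_iff Quad_simps using Q q t
    by (simp add: p pol_closed N.smult_r_distr N.smult_assoc1[symmetric] S.m_comm)
qed

end

section \<open>Quadratic maps on S^2\<close>

abbreviation S2 where "S2 \<equiv> direct_sum (self_module S) (self_module S)"
abbreviation e1 where "e1 \<equiv> (\<one>\<^bsub>S\<^esub>, \<zero>\<^bsub>S\<^esub>)"
abbreviation e2 where "e2 \<equiv> (\<zero>\<^bsub>S\<^esub>, \<one>\<^bsub>S\<^esub>)"

lemma module_S2: "module S S2"
proof (rule moduleI)
  show "abelian_group S2"
  proof (rule abelian_groupI)
    show "\<exists>y\<in>carrier S2. y \<oplus>\<^bsub>S2\<^esub> x = \<zero>\<^bsub>S2\<^esub>" if "x \<in> carrier S2" for x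
      using that by (intro bexI[of _ "(\<ominus>\<^bsub>S\<^esub> fst x, \<ominus>\<^bsub>S\<^esub> snd x)"]) (auto simp: S.l_neg)
  qed (auto simp: S.a_ac)
qed (auto simp: S.cring_axioms S.l_distr S.r_distr S.m_ac)

text \<open>Together with \<open>Quad_S2_eq\<close> this makes n1, n2 and beta free coordinates for
  quadratic maps on S^2: any choice is allowed, and beta is recovered from the polarisation.\<close>

lemma Quad_S2I:
  assumes "q \<in> extensional (carrier S \<times> carrier S)" "polar_form R S \<phi> N \<beta>"
    and n: "n1 \<in> carrier N" "n2 \<in> carrier N"
    and q: "\<And>x y. x \<in> carrier S \<Longrightarrow> y \<in> carrier S \<Longrightarrow>
      q (x, y) = (x \<otimes>\<^bsub>S\<^esub> x) \<odot>\<^bsub>N\<^esub> n1 \<oplus>\<^bsub>N\<^esub> (y \<otimes>\<^bsub>S\<^esub> y) \<odot>\<^bsub>N\<^esub> n2 \<oplus>\<^bsub>N\<^esub> \<beta> x y"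
  shows "q \<in> carrier (Quad R S \<phi> S2 N)"
    and "\<And>x y. x \<in> carrier S \<Longrightarrow> y \<in> carrier S \<Longrightarrow> pol S2 N q (x \<odot>\<^bsub>S2\<^esub> e1) (y \<odot>\<^bsub>S2\<^esub> e2) = \<beta> x y"
proof -
  interpret \<beta>: polar_form R S \<phi> N \<beta> by fact
  have q_closed: "q z \<in> carrier N" if "z \<in> carrier S2" for z
    using that n \<beta>.closed by (auto simp: q)
  \<comment> \<open>The expected polarisation: x^2 n1 contributes 2 x x' n1, with the factor 2
    written as a sum, likewise for n2, and beta(x, y) contributes beta(x, y') + beta(x', y).\<close>
  define B where "B x y x' y' = ((x \<otimes>\<^bsub>S\<^esub> x' \<oplus>\<^bsub>S\<^esub> x \<otimes>\<^bsub>S\<^esub> x') \<odot>\<^bsub>N\<^esub> n1 \<oplus>\<^bsub>N\<^esub>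
      (y \<otimes>\<^bsub>S\<^esub> y' \<oplus>\<^bsub>S\<^esub> y \<otimes>\<^bsub>S\<^esub> y') \<odot>\<^bsub>N\<^esub> n2) \<oplus>\<^bsub>N\<^esub> (\<beta> x y' \<oplus>\<^bsub>N\<^esub> \<beta> x' y)" for x y x' y'
  have pol: "pol S2 N q (x, y) (x', y') = B x y x' y'"
    if "x \<in> carrier S" "y \<in> carrier S" "x' \<in> carrier S" "y' \<in> carrier S" for x y x' y'
  proof (rule pol_eqI[OF module_S2])
    show "B x y x' y' \<in> carrier N"
      using that n by (simp add: B_def \<beta>.closed)
    show "q ((x, y) \<oplus>\<^bsub>S2\<^esub> (x', y')) = q (x, y) \<oplus>\<^bsub>N\<^esub> q (x', y') \<oplus>\<^bsub>N\<^esub> B x y x' y'"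
      using that n
      by (simp add: q B_def S.l_distr S.r_distr S.m_comm N.smult_l_distr \<beta>.add_left \<beta>.add_right
          \<beta>.closed N.a_ac)
  qed (use that q_closed in simp_all)
  have square: "(s \<otimes>\<^bsub>S\<^esub> x \<otimes>\<^bsub>S\<^esub> (s \<otimes>\<^bsub>S\<^esub> x)) \<odot>\<^bsub>N\<^esub> n = (s \<otimes>\<^bsub>S\<^esub> s) \<odot>\<^bsub>N\<^esub> ((x \<otimes>\<^bsub>S\<^esub> x) \<odot>\<^bsub>N\<^esub> n)"
    if "s \<in> carrier S" "x \<in> carrier S" "n \<in> carrier N" for s x n
    using that by (simp add: S.m_ac flip: N.smult_assoc1)
  show "q \<in> carrier (Quad R S \<phi> S2 N)"
    unfolding Quad_iff[OF module_S2]
  proof (intro conjI ballI)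
    show "q \<in> carrier S2 \<rightarrow>\<^sub>E carrier N"
      using q_closed assms(1) by (simp add: PiE_def)
  next
    fix s z assume "s \<in> carrier S" "z \<in> carrier S2"
    then show "q (s \<odot>\<^bsub>S2\<^esub> z) = (s \<otimes>\<^bsub>S\<^esub> s) \<odot>\<^bsub>N\<^esub> q z"
      using n by (cases z) (simp add: q \<beta>.scale_both \<beta>.closed N.smult_r_distr square)
  next
    fix u v w assume "u \<in> carrier S2" "v \<in> carrier S2" "w \<in> carrier S2"
    then show "pol S2 N q u (v \<oplus>\<^bsub>S2\<^esub> w) = pol S2 N q u v \<oplus>\<^bsub>N\<^esub> pol S2 N q u w"
      using n by (cases u, cases v, cases w) (simp add: pol B_def \<beta>.add_left \<beta>.add_right \<beta>.closed
          S.r_distr N.smult_l_distr N.a_ac)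
  next
    fix r u v assume "r \<in> carrier R" "u \<in> carrier S2" "v \<in> carrier S2"
    then show "pol S2 N q u (\<phi> r \<odot>\<^bsub>S2\<^esub> v) = \<phi> r \<odot>\<^bsub>N\<^esub> pol S2 N q u v"
      using n by (cases u, cases v) (simp add: pol B_def \<beta>.scale_left \<beta>.scale_right \<beta>.closed
          N.smult_l_distr N.smult_r_distr N.smult_assoc1[symmetric] S.m_lcomm)
  qed
  \<comment> \<open>On the vectors (x, 0) and (0, y) the form \<open>B\<close> reduces to beta(x, y)
    + beta(0, 0); scaling by s = 0 removes the second term.\<close>
  have zero: "\<beta> \<zero>\<^bsub>S\<^esub> \<zero>\<^bsub>S\<^esub> = \<zero>\<^bsub>N\<^esub>"
    using \<beta>.scale_both[of "\<zero>\<^bsub>S\<^esub>" "\<zero>\<^bsub>S\<^esub>" "\<zero>\<^bsub>S\<^esub>"] by (simp add: \<beta>.closed)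
  show "pol S2 N q (x \<odot>\<^bsub>S2\<^esub> e1) (y \<odot>\<^bsub>S2\<^esub> e2) = \<beta> x y" if "x \<in> carrier S" "y \<in> carrier S" for x y
    using that n by (simp add: pol B_def zero \<beta>.closed)
qed

lemma Quad_S2_eq:
  assumes Q: "q \<in> carrier (Quad R S \<phi> S2 N)" and "x \<in> carrier S" "y \<in> carrier S"
  shows "q (x, y) = (x \<otimes>\<^bsub>S\<^esub> x) \<odot>\<^bsub>N\<^esub> q e1 \<oplus>\<^bsub>N\<^esub> (y \<otimes>\<^bsub>S\<^esub> y) \<odot>\<^bsub>N\<^esub> q e2 \<oplus>\<^bsub>N\<^esub>
    pol S2 N q (x \<odot>\<^bsub>S2\<^esub> e1) (y \<odot>\<^bsub>S2\<^esub> e2)"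
proof -
  note Q = Q[unfolded Quad_iff[OF module_S2]]
  have "q (x, y) = q (x \<odot>\<^bsub>S2\<^esub> e1 \<oplus>\<^bsub>S2\<^esub> y \<odot>\<^bsub>S2\<^esub> e2)"
    using assms by simp
  also have "\<dots> = q (x \<odot>\<^bsub>S2\<^esub> e1) \<oplus>\<^bsub>N\<^esub> q (y \<odot>\<^bsub>S2\<^esub> e2) \<oplus>\<^bsub>N\<^esub> pol S2 N q (x \<odot>\<^bsub>S2\<^esub> e1) (y \<odot>\<^bsub>S2\<^esub> e2)"
    using Q assms(2,3) by (intro pol_eq[OF module_S2]) (blast, simp_all)
  also have "q (x \<odot>\<^bsub>S2\<^esub> e1) = (x \<otimes>\<^bsub>S\<^esub> x) \<odot>\<^bsub>N\<^esub> q e1"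
    using Q assms(2,3) by (simp del: direct_sum_simps(3))
  also have "q (y \<odot>\<^bsub>S2\<^esub> e2) = (y \<otimes>\<^bsub>S\<^esub> y) \<odot>\<^bsub>N\<^esub> q e2"
    using Q assms(2,3) by (simp del: direct_sum_simps(3))
  finally show ?thesis .
qed

text \<open>Facts about \<open>Quad\<close> become facts about \<open>Quad_id\<close> when phi is
  the identity of \<open>S\<close>.\<close>

lemma ring_extension_module_id: "ring_extension_module S S (\<lambda>s. s) N"
  unfolding ring_extension_module_def ring_extension_def ring_hom_cring_def ring_hom_cring_axioms_def
  using S.cring_axioms N.module_axioms by (simp add: ring_hom_memI)

text \<open>
  The locale is instantiated rather than interpreted at the identity, because the homomorphism
  laws become looping simp rules \<open>x \<oplus> y = x \<oplus> y\<close> there.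
\<close>

lemmas Quad_id_iff = ring_extension_module.Quad_iff[OF ring_extension_module_id]
  and polar_form_pol_id = ring_extension_module.polar_form_pol[OF ring_extension_module_id]
  and Quad_id_add_closed = ring_extension_module.Quad_add_closed[OF ring_extension_module_id]
  and Quad_id_smult_closed = ring_extension_module.Quad_smult_closed[OF ring_extension_module_id]
  and Quad_id_S2I = ring_extension_module.Quad_S2I[OF ring_extension_module_id]
  and Quad_id_S2_eq = ring_extension_module.Quad_S2_eq[OF ring_extension_module_id]

lemma polar_form_id:
  assumes "polar_form S S (\<lambda>s. s) N \<beta>" "x \<in> carrier S" "y \<in> carrier S"
  shows "\<beta> x y = (x \<otimes>\<^bsub>S\<^esub> y) \<odot>\<^bsub>N\<^esub> \<beta> \<one>\<^bsub>S\<^esub> \<one>\<^bsub>S\<^esub>"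
proof -
  interpret \<beta>: polar_form S S "\<lambda>s. s" N \<beta> by fact
  show ?thesis
    using assms \<beta>.scale_left[of x "\<one>\<^bsub>S\<^esub>" y] \<beta>.scale_right[of y "\<one>\<^bsub>S\<^esub>" "\<one>\<^bsub>S\<^esub>"]
    by (simp add: N.smult_assoc1 \<beta>.closed)
qed

lemma polar_form_id_mult:
  assumes "n \<in> carrier N"
  shows "polar_form S S (\<lambda>s. s) N (\<lambda>x y. (x \<otimes>\<^bsub>S\<^esub> y) \<odot>\<^bsub>N\<^esub> n)"
  using assms
  by unfold_locales
    (simp_all add: S.l_distr S.r_distr N.smult_l_distr N.smult_assoc1[symmetric] S.m_ac)

lemma Quad_id_subset: "carrier (Quad_id S M N) \<subseteq> carrier (Quad R S \<phi> M N)"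
  by (rule Quad_id_subset_Quad) (rule ring_hom_cring_axioms)

text \<open>The right side of \<open>aug_pullback_iso_iff\<close>, with which (a) and (b) are
  compared as well. The scalar n in x y n is written beta(1, 1) because x = y = 1 leaves no other
  choice.\<close>

definition polar_forms_scalar where
  "polar_forms_scalar \<longleftrightarrow> (\<forall>\<beta>. polar_form R S \<phi> N \<beta> \<longrightarrow>
      (\<forall>x\<in>carrier S. \<forall>y\<in>carrier S. \<beta> x y = (x \<otimes>\<^bsub>S\<^esub> y) \<odot>\<^bsub>N\<^esub> \<beta> \<one>\<^bsub>S\<^esub> \<one>\<^bsub>S\<^esub>))"

text \<open>By \<open>Quad_iff\<close> the two notions differ in one condition only: homogeneity of
  \<open>pol\<close> in its second argument over \<open>S\<close> instead of over \<open>R\<close>.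
  The form along x and y, evaluated at (1, s), supplies it.\<close>

lemma Quad_eq_if_polar_forms_scalar:
  assumes P: polar_forms_scalar and M: "module S M"
  shows "carrier (Quad_id S M N) = carrier (Quad R S \<phi> M N)"
proof (rule equalityI[OF Quad_id_subset subsetI])
  interpret M: module S M by (rule M)
  fix q assume q: "q \<in> carrier (Quad R S \<phi> M N)"
  have "pol M N q x (s \<odot>\<^bsub>M\<^esub> y) = s \<odot>\<^bsub>N\<^esub> pol M N q x y"
    if "s \<in> carrier S" "x \<in> carrier M" "y \<in> carrier M" for s x y
  proof -
    have "pol M N q (\<one>\<^bsub>S\<^esub> \<odot>\<^bsub>M\<^esub> x) (s \<odot>\<^bsub>M\<^esub> y) =
        (\<one>\<^bsub>S\<^esub> \<otimes>\<^bsub>S\<^esub> s) \<odot>\<^bsub>N\<^esub> pol M N q (\<one>\<^bsub>S\<^esub> \<odot>\<^bsub>M\<^esub> x) (\<one>\<^bsub>S\<^esub> \<odot>\<^bsub>M\<^esub> y)"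
      using P polar_form_pol[OF M q that(2,3)] S.one_closed that(1)
      unfolding polar_forms_scalar_def by blast
    then show ?thesis
      using that by simp
  qed
  then show "q \<in> carrier (Quad_id S M N)"
    using q unfolding Quad_iff[OF M] Quad_id_iff[OF M] by blast
qed

lemma polar_forms_scalar_if_Quad_eq:
  assumes eq: "carrier (Quad_id S S2 N) = carrier (Quad R S \<phi> S2 N)"
  shows polar_forms_scalar
  unfolding polar_forms_scalar_def
proof (intro allI impI ballI)
  fix \<beta> x y
  assume \<beta>: "polar_form R S \<phi> N \<beta>" and xy: "x \<in> carrier S" "y \<in> carrier S"
  interpret \<beta>: polar_form R S \<phi> N \<beta> by fact
  \<comment> \<open>The form itself, read as a function of one vector of S^2, is quadratic with n1 =
    n2 = 0, and its restricted polarisation is the form again. So every form arises from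
    S^2.\<close>
  define q where "q = (\<lambda>z\<in>carrier S \<times> carrier S. \<beta> (fst z) (snd z))"
  have Q: "q \<in> carrier (Quad R S \<phi> S2 N)"
    and pol: "\<And>x y. x \<in> carrier S \<Longrightarrow> y \<in> carrier S \<Longrightarrow> pol S2 N q (x \<odot>\<^bsub>S2\<^esub> e1) (y \<odot>\<^bsub>S2\<^esub> e2) = \<beta> x y"
    by (rule Quad_S2I[OF _ \<beta>, of q "\<zero>\<^bsub>N\<^esub>" "\<zero>\<^bsub>N\<^esub>"]; simp add: q_def \<beta>.closed)+
  have "polar_form S S (\<lambda>s. s) N (\<lambda>x y. pol S2 N q (x \<odot>\<^bsub>S2\<^esub> e1) (y \<odot>\<^bsub>S2\<^esub> e2))"
    using Q eq by (intro polar_form_pol_id[OF module_S2]) auto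
  from polar_form_id[OF this xy] show "\<beta> x y = (x \<otimes>\<^bsub>S\<^esub> y) \<odot>\<^bsub>N\<^esub> \<beta> \<one>\<^bsub>S\<^esub> \<one>\<^bsub>S\<^esub>"
    using xy by (simp add: pol del: direct_sum_simps(3))
qed

text \<open>Over \<open>S\<close> such a map is a binary quadratic form with three coefficients:
  p(1, 0), p(0, 1) and the cross term p(1, 1) - p(1, 0) - p(0, 1).\<close>

lemma Quad_id_S2_eqI:
  assumes p: "p \<in> carrier (Quad_id S S2 N)" and p': "p' \<in> carrier (Quad_id S S2 N)"
    and eq: "p e1 = p' e1" "p e2 = p' e2" "p (\<one>\<^bsub>S\<^esub>, \<one>\<^bsub>S\<^esub>) = p' (\<one>\<^bsub>S\<^esub>, \<one>\<^bsub>S\<^esub>)"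
  shows "p = p'"
proof -
  have form: "p (x, y) = (x \<otimes>\<^bsub>S\<^esub> x) \<odot>\<^bsub>N\<^esub> p e1 \<oplus>\<^bsub>N\<^esub> (y \<otimes>\<^bsub>S\<^esub> y) \<odot>\<^bsub>N\<^esub> p e2 \<oplus>\<^bsub>N\<^esub>
      (x \<otimes>\<^bsub>S\<^esub> y) \<odot>\<^bsub>N\<^esub> (p (\<one>\<^bsub>S\<^esub>, \<one>\<^bsub>S\<^esub>) \<ominus>\<^bsub>N\<^esub> p e1 \<ominus>\<^bsub>N\<^esub> p e2)"
    if p: "p \<in> carrier (Quad_id S S2 N)" and xy: "x \<in> carrier S" "y \<in> carrier S" for p x y
    using Quad_id_S2_eq[OF p xy] polar_form_id[OF polar_form_pol_id[OF module_S2 p, of e1 e2] xy]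
    by (simp add: pol_def[of S2 N p e1 e2])
  have "p \<in> extensional (carrier S \<times> carrier S)" "p' \<in> extensional (carrier S \<times> carrier S)"
    using p p' unfolding Quad_id_iff[OF module_S2] by (simp_all add: PiE_def)
  then show ?thesis
  proof (rule extensionalityI)
    fix z assume "z \<in> carrier S \<times> carrier S"
    then obtain x y where z: "z = (x, y)" "x \<in> carrier S" "y \<in> carrier S"
      by blast
    show "p z = p' z"
      unfolding z(1) form[OF p z(2,3)] form[OF p' z(2,3)] eq ..
  qed
qed

section \<open>The decomposition of $Quad(S^2, N)$\<close>

definition Quad_S2_sum where
  "Quad_S2_sum = (\<lambda>(p, g). \<lambda>z\<in>carrier S \<times> carrier S.
    p z \<oplus>\<^bsub>N\<^esub> g (W_proj (qe (e (fst z) (snd z)) \<one>\<^bsub>S\<^esub>)))"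

text \<open>For injectivity, the summand coming from g vanishes at (1, 0), (0, 1) and (1, 1), the
  three points that determine p; so p is recovered, and g follows by cancellation. For surjectivity,
  the polar form of q extends to a linear map h on Q, whose value at 1 goes into p and whose
  restriction to W is g.\<close>

lemma module_iso_Quad_S2_sum:
  "module_iso S (direct_sum (Quad_id S S2 N) (Hom S WM N)) (Quad R S \<phi> S2 N) Quad_S2_sum"
    (is "module_iso S ?A ?B ?F")
proof -
  have W: "W_proj X \<in> carrier WM" if "X \<in> carrier QR" for X
    using linear_mapD(1)[OF linear_map_W_proj, of X] that by simp
  have lin: "linear_map S QM N (\<lambda>X. g (W_proj X))" if "linear_map S WM N g" for g
    by (rule linear_map_compose[OF linear_map_W_proj that])
  have closed: "?F (p, g) \<in> carrier ?B"
    if p: "p \<in> carrier (Quad_id S S2 N)" and g: "g \<in> carrier (Hom S WM N)" for p g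
  proof -
    define q where "q = (\<lambda>z\<in>carrier S \<times> carrier S. g (W_proj (qe (e (fst z) (snd z)) \<one>\<^bsub>S\<^esub>)))"
    have "q \<in> carrier ?B"
      by (rule Quad_S2I(1)[OF _ polar_form_of_linear_map[OF lin[of g]], of q "\<zero>\<^bsub>N\<^esub>" "\<zero>\<^bsub>N\<^esub>"])
        (use g in \<open>simp_all add: q_def linear_mapD(1)[OF lin]\<close>)
    then have "p \<oplus>\<^bsub>?B\<^esub> q \<in> carrier ?B"
      using p Quad_id_subset by (intro Quad_add_closed[OF module_S2]) auto
    also have "p \<oplus>\<^bsub>?B\<^esub> q = ?F (p, g)"
      by (auto simp: Quad_S2_sum_def q_def fun_eq_iff)
    finally show ?thesis .
  qed
  have p_closed: "p z \<in> carrier N" if "p \<in> carrier (Quad_id S S2 N)" "z \<in> carrier S \<times> carrier S" for p z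
    using that unfolding Quad_id_iff[OF module_S2] by auto
  have "linear_map S ?A ?B ?F"
  proof (rule linear_mapI)
    show "?F a \<in> carrier ?B" if "a \<in> carrier ?A" for a
      using that closed by (cases a) simp
    show "?F (a \<oplus>\<^bsub>?A\<^esub> b) = ?F a \<oplus>\<^bsub>?B\<^esub> ?F b" if "a \<in> carrier ?A" "b \<in> carrier ?A" for a b
      using that W
      by (cases a, cases b)
        (auto simp: Quad_S2_sum_def fun_eq_iff p_closed linear_mapD(1) N.a_ac simp del: WM_simps(1))
    show "?F (s \<odot>\<^bsub>?A\<^esub> a) = s \<odot>\<^bsub>?B\<^esub> ?F a" if "s \<in> carrier S" "a \<in> carrier ?A" for s a
      using that W
      by (cases a)
        (auto simp: Quad_S2_sum_def fun_eq_iff p_closed linear_mapD(1) N.smult_r_distr simp del: WM_simps(1))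
  qed
  moreover have "inj_on ?F (carrier ?A)"
  proof (rule inj_onI)
    fix a a'
    assume a: "a \<in> carrier ?A" "a' \<in> carrier ?A" "?F a = ?F a'"
    obtain p g p' g' where pg: "a = (p, g)" "a' = (p', g')"
      by (cases a, cases a')
    then have p: "p \<in> carrier (Quad_id S S2 N)" "p' \<in> carrier (Quad_id S S2 N)"
      and ext: "g \<in> extensional (carrier WM)" "g' \<in> extensional (carrier WM)"
      and g: "linear_map S WM N g" "linear_map S WM N g'"
      using a by (simp_all del: WM_simps(1))
    have eq: "p (x, y) \<oplus>\<^bsub>N\<^esub> g (W_proj (qe (e x y) \<one>\<^bsub>S\<^esub>)) = p' (x, y) \<oplus>\<^bsub>N\<^esub> g' (W_proj (qe (e x y) \<one>\<^bsub>S\<^esub>))"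
      if "x \<in> carrier S" "y \<in> carrier S" for x y
      using fun_cong[OF a(3), of "(x, y)"] that by (simp add: Quad_S2_sum_def pg)
    have zero: "g (W_proj (qe (e \<one>\<^bsub>S\<^esub> \<zero>\<^bsub>S\<^esub>) \<one>\<^bsub>S\<^esub>)) = \<zero>\<^bsub>N\<^esub>"
      "g (W_proj (qe (e \<zero>\<^bsub>S\<^esub> \<one>\<^bsub>S\<^esub>) \<one>\<^bsub>S\<^esub>)) = \<zero>\<^bsub>N\<^esub>"
      "g (W_proj unitQ) = \<zero>\<^bsub>N\<^esub>" if g: "linear_map S WM N g" for g
    proof -
      interpret \<beta>: polar_form R S \<phi> N "\<lambda>x y. g (W_proj (qe (e x y) \<one>\<^bsub>S\<^esub>))"
        by (rule polar_form_of_linear_map[OF lin[OF g]])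
      \<comment> \<open>A form vanishes as soon as one argument is zero, by homogeneity with r =
        0.\<close>
      show "g (W_proj (qe (e \<one>\<^bsub>S\<^esub> \<zero>\<^bsub>S\<^esub>) \<one>\<^bsub>S\<^esub>)) = \<zero>\<^bsub>N\<^esub>"
        using \<beta>.scale_right[of "\<zero>\<^bsub>R\<^esub>" "\<one>\<^bsub>S\<^esub>" "\<zero>\<^bsub>S\<^esub>"] \<beta>.closed[of "\<one>\<^bsub>S\<^esub>" "\<zero>\<^bsub>S\<^esub>"] by simp
      show "g (W_proj (qe (e \<zero>\<^bsub>S\<^esub> \<one>\<^bsub>S\<^esub>) \<one>\<^bsub>S\<^esub>)) = \<zero>\<^bsub>N\<^esub>"
        using \<beta>.scale_left[of "\<zero>\<^bsub>R\<^esub>" "\<zero>\<^bsub>S\<^esub>" "\<one>\<^bsub>S\<^esub>"] \<beta>.closed[of "\<zero>\<^bsub>S\<^esub>" "\<one>\<^bsub>S\<^esub>"] by simp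
      \<comment> \<open>Let c be this value. As \<open>W_proj\<close> is idempotent and 1 has
        augmentation 1, \<open>W_proj_linear_restrict\<close> reads c + c = c.\<close>
      show "g (W_proj unitQ) = \<zero>\<^bsub>N\<^esub>"
        using W_proj_linear_restrict[OF lin[OF g], of unitQ] \<beta>.closed[of "\<one>\<^bsub>S\<^esub>" "\<one>\<^bsub>S\<^esub>"]
        by (simp add: W_proj_eq[OF W] Q_aug_pure)
    qed
    have "p = p'"
      using eq[of "\<one>\<^bsub>S\<^esub>" "\<zero>\<^bsub>S\<^esub>"] eq[of "\<zero>\<^bsub>S\<^esub>" "\<one>\<^bsub>S\<^esub>"] eq[of "\<one>\<^bsub>S\<^esub>" "\<one>\<^bsub>S\<^esub>"]
      by (intro Quad_id_S2_eqI p) (simp_all add: zero[OF g(1)] zero[OF g(2)] p_closed p)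
    \<comment> \<open>The generators x (x) y (x) 1 of Q need not lie in W, so g and g' are compared
      after composition with \<open>W_proj\<close>, which is the identity on W.\<close>
    have "g (W_proj X) = g' (W_proj X)" if "X \<in> carrier QR" for X
    proof (rule linear_map_Q_eqI[OF lin[OF g(1)] lin[OF g(2)] _ that])
      fix x y assume xy: "x \<in> carrier S" "y \<in> carrier S"
      show "g (W_proj (qe (e x y) \<one>\<^bsub>S\<^esub>)) = g' (W_proj (qe (e x y) \<one>\<^bsub>S\<^esub>))"
        using eq[OF xy] p_closed[OF p(2), of "(x, y)"] xy
          linear_mapD(1)[OF lin[OF g(1)], of "qe (e x y) \<one>\<^bsub>S\<^esub>"]
          linear_mapD(1)[OF lin[OF g(2)], of "qe (e x y) \<one>\<^bsub>S\<^esub>"]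
        unfolding \<open>p = p'\<close> by simp
    qed
    then have "g X = g' X" if "X \<in> carrier WM" for X
      using that W_proj_eq[OF that] by (metis WM_simps(1))
    then have "g = g'"
      using ext by (intro extensionalityI) auto
    then show "a = a'"
      using pg \<open>p = p'\<close> by simp
  qed
  moreover have "q \<in> ?F ` carrier ?A" if q: "q \<in> carrier ?B" for q
  proof -
    obtain h where h: "linear_map S QM N h"
      and h\<beta>: "\<And>x y. x \<in> carrier S \<Longrightarrow> y \<in> carrier S \<Longrightarrow>
        h (qe (e x y) \<one>\<^bsub>S\<^esub>) = pol S2 N q (x \<odot>\<^bsub>S2\<^esub> e1) (y \<odot>\<^bsub>S2\<^esub> e2)"
      using linear_map_of_polar_form[OF polar_form_pol[OF module_S2 q, of e1 e2]] by auto
    have h_closed: "h X \<in> carrier N" if "X \<in> carrier QR" for X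
      using linear_mapD(1)[OF h] that by simp
    have q_closed: "q z \<in> carrier N" if "z \<in> carrier S \<times> carrier S" for z
      using q that unfolding Quad_iff[OF module_S2] by auto
    \<comment> \<open>The polar form of q splits along Q = S 1 (+) W: the part x y h(1) is
      S-bilinear and joins p, the rest is carried by g.\<close>
    define p where "p = (\<lambda>z\<in>carrier S \<times> carrier S. (fst z \<otimes>\<^bsub>S\<^esub> fst z) \<odot>\<^bsub>N\<^esub> q e1 \<oplus>\<^bsub>N\<^esub>
      (snd z \<otimes>\<^bsub>S\<^esub> snd z) \<odot>\<^bsub>N\<^esub> q e2 \<oplus>\<^bsub>N\<^esub> (fst z \<otimes>\<^bsub>S\<^esub> snd z) \<odot>\<^bsub>N\<^esub> h unitQ)"
    define g where "g = restrict h (carrier WM)"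
    have p: "p \<in> carrier (Quad_id S S2 N)"
      by (rule Quad_id_S2I(1)[OF _ polar_form_id_mult[of "h unitQ"], of p "q e1" "q e2"])
        (simp_all add: p_def h_closed q_closed)
    have "linear_map S WM N g"
      unfolding g_def using linear_mapD[OF h]
      by (intro linear_mapI)
        (simp_all add: QR_add_closed QM_smult_closed Q_aug_add Q_aug_smult del: QM_simps(4))
    then have g: "g \<in> carrier (Hom S WM N)"
      by (simp add: g_def del: WM_simps(1))
    have "?F (p, g) (x, y) = q (x, y)" if xy: "x \<in> carrier S" "y \<in> carrier S" for x y
    proof -
      let ?X = "qe (e x y) \<one>\<^bsub>S\<^esub>"
      have X: "?X \<in> carrier QR" "W_proj ?X \<in> carrier QR" "W_proj ?X \<in> carrier WM"
        using xy W[of ?X] by auto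
      have "h (W_proj ?X) \<oplus>\<^bsub>N\<^esub> (x \<otimes>\<^bsub>S\<^esub> y) \<odot>\<^bsub>N\<^esub> h unitQ = h ?X"
        using W_proj_linear_restrict[OF h X(1)] xy by (simp add: Q_aug_pure)
      then have "q (x, y) = (x \<otimes>\<^bsub>S\<^esub> x) \<odot>\<^bsub>N\<^esub> q e1 \<oplus>\<^bsub>N\<^esub> (y \<otimes>\<^bsub>S\<^esub> y) \<odot>\<^bsub>N\<^esub> q e2 \<oplus>\<^bsub>N\<^esub>
          (h (W_proj ?X) \<oplus>\<^bsub>N\<^esub> (x \<otimes>\<^bsub>S\<^esub> y) \<odot>\<^bsub>N\<^esub> h unitQ)"
        using Quad_S2_eq[OF q xy] h\<beta>[OF xy] by simp
      also have "\<dots> = ?F (p, g) (x, y)"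
        using xy X by (simp add: Quad_S2_sum_def p_def g_def h_closed q_closed N.a_ac del: WM_simps(1))
      finally show ?thesis ..
    qed
    moreover have "q \<in> extensional (carrier S \<times> carrier S)"
      using q unfolding Quad_iff[OF module_S2] by (simp add: PiE_def)
    moreover have "?F (p, g) \<in> extensional (carrier S \<times> carrier S)"
      by (simp add: Quad_S2_sum_def)
    ultimately have "?F (p, g) = q"
      by (intro extensionalityI) auto
    then show ?thesis
      using p g by (auto intro!: image_eqI[of _ _ "(p, g)"] simp del: WM_simps(1) Hom_simps(1))
  qed
  ultimately show ?thesis
    unfolding module_iso_def bij_betw_def using linear_mapD(1) by (auto simp del: direct_sum_simps(1))
qed

text \<open>\<open>Quad_S2_sum\<close> runs from the direct sum to the quadratic maps and has to be
  inverted; the closure facts for \<open>Hom\<close> serve that purpose.\<close>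

lemma isomorphic_Quad_S2:
  "isomorphic_modules S (Quad R S \<phi> S2 N) (direct_sum (Quad_id S S2 N) (Hom S WM N))"
proof -
  have Hom_add: "g \<oplus>\<^bsub>Hom S WM N\<^esub> g' \<in> carrier (Hom S WM N)"
    if "g \<in> carrier (Hom S WM N)" "g' \<in> carrier (Hom S WM N)" for g g'
  proof -
    have g: "linear_map S WM N g" "linear_map S WM N g'"
      using that by simp_all
    have "linear_map S WM N (g \<oplus>\<^bsub>Hom S WM N\<^esub> g')"
      using linear_mapD[OF g(1)] linear_mapD[OF g(2)]
      by (intro linear_mapI) (simp_all add: QR_add_closed QM_smult_closed Q_aug_add Q_aug_smult
          N.a_ac N.smult_r_distr del: QM_simps(4))
    then show ?thesis
      by (simp del: WM_simps(1))
  qed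
  have Hom_smult: "s \<odot>\<^bsub>Hom S WM N\<^esub> g \<in> carrier (Hom S WM N)"
    if "s \<in> carrier S" "g \<in> carrier (Hom S WM N)" for s g
  proof -
    have g: "linear_map S WM N g"
      using that by simp
    have "linear_map S WM N (s \<odot>\<^bsub>Hom S WM N\<^esub> g)"
      using linear_mapD[OF g] that(1)
      by (intro linear_mapI) (simp_all add: QR_add_closed QM_smult_closed Q_aug_add Q_aug_smult
          N.smult_r_distr N.smult_assoc1[symmetric] S.m_comm del: QM_simps(4))
    then show ?thesis
      by (simp del: WM_simps(1))
  qed
  show ?thesis
  proof (rule isomorphic_modules_sym[OF module_iso_Quad_S2_sum])
    let ?A = "direct_sum (Quad_id S S2 N) (Hom S WM N)"
    show "a \<oplus>\<^bsub>?A\<^esub> b \<in> carrier ?A" if "a \<in> carrier ?A" "b \<in> carrier ?A" for a b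
      using that Hom_add Quad_id_add_closed[OF module_S2]
      by (cases a, cases b) (simp del: Hom_simps Quad_simps)
    show "s \<odot>\<^bsub>?A\<^esub> a \<in> carrier ?A" if "s \<in> carrier S" "a \<in> carrier ?A" for s a
      using that Hom_smult Quad_id_smult_closed[OF module_S2]
      by (cases a) (simp del: Hom_simps Quad_simps)
  qed
qed

end

theorem proposition2p5:
  fixes R :: "('r, 'p) ring_scheme" and S :: "('s, 'q) ring_scheme" and \<phi> :: "'r \<Rightarrow> 's"
    and N :: "('s, 'n, 'y) module_scheme"
  assumes "ring_hom_cring R S \<phi>" and "module S N"
  shows
    "(let
        a = (\<forall>M :: ('s, 'm) module. module S M \<longrightarrow>
               carrier (Quad_id S M N) = carrier (Quad R S \<phi> M N)) \<and>
            (\<forall>M :: ('s, 's \<times> 's) module. module S M \<longrightarrow>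
               carrier (Quad_id S M N) = carrier (Quad R S \<phi> M N));
        S2 = direct_sum (self_module S) (self_module S);
        b = (carrier (Quad_id S S2 N) = carrier (Quad R S \<phi> S2 N));
        c = module_iso S N (Hom S (Q_module R S \<phi>) N)
              (\<lambda>n. aug_pullback R S \<phi> (scalar_hom S N n))
      in (a \<longleftrightarrow> b) \<and> (b \<longleftrightarrow> c) \<and>
         isomorphic_modules S (Quad R S \<phi> S2 N)
           (direct_sum (Quad_id S S2 N) (Hom S (W_module R S \<phi>) N)))"
proof -
  interpret ring_extension_module R S \<phi> N
    unfolding ring_extension_module_def ring_extension_def using assms by simp
  let ?c = "module_iso S N (Hom S (Q_module R S \<phi>) N) (\<lambda>n. aug_pullback R S \<phi> (scalar_hom S N n))"
  have c: "?c \<longleftrightarrow> polar_forms_scalar"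
    unfolding aug_pullback_iso_iff polar_forms_scalar_def ..
  \<comment> \<open>S^2 is one of the modules for which scalar forms give equality, and equality for
    S^2 already yields scalar forms.\<close>
  have b: "carrier (Quad_id S S2 N) = carrier (Quad R S \<phi> S2 N) \<longleftrightarrow> polar_forms_scalar"
    using Quad_eq_if_polar_forms_scalar[OF _ module_S2] polar_forms_scalar_if_Quad_eq by blast
  have a: "(\<forall>M :: ('s, 'm) module. module S M \<longrightarrow>
        carrier (Quad_id S M N) = carrier (Quad R S \<phi> M N)) \<and>
      (\<forall>M :: ('s, 's \<times> 's) module. module S M \<longrightarrow>
        carrier (Quad_id S M N) = carrier (Quad R S \<phi> M N)) \<longleftrightarrow> polar_forms_scalar"
      (is "?a \<longleftrightarrow> _")
  proof
    assume ?a
    \<comment> \<open>S^2 has its elements in \<open>'s \<times> 's\<close>, so the second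
      quantifier reaches it whatever the type \<open>'m\<close> is.\<close>
    then have "carrier (Quad_id S S2 N) = carrier (Quad R S \<phi> S2 N)"
      using module_S2 by blast
    then show polar_forms_scalar
      using b by blast
  next
    assume polar_forms_scalar
    then show ?a
      by (intro conjI allI impI Quad_eq_if_polar_forms_scalar)
  qed
  show ?thesis
    unfolding Let_def a b c using isomorphic_Quad_S2 by simp
qed

end
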